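(* Let $r,s\in(0,+\infty)$ and let $X$ be a random variable taking values in $\mathbb{R}^d$ with distribution $P$ whose absolutely continuous part (with respect to Lebesgue measure $\lambda_d$) is $P_a=f\cdot\lambda_d\not\equiv 0$. Suppose that $\mathbb{E}|X|^{r+\eta}<\infty$ for some $\eta>0$. Let $(\alpha_n)_{n\ge1}$ be an asymptotically $L^r(P)$-optimal sequence of quantizers. Then, for every $\theta>0$ and every $\mu\in\mathbb{R}^d$, $$\liminf_{n\to+\infty} n^{s/d}\,\|X-\widehat X^{\alpha_n^{\theta,\mu}}\|_s^s\;\ge\; Q_{r,s}^{\mathrm{Inf}}(P,\theta),$$ where $$Q_{r,s}^{\mathrm{Inf}}(P,\theta)=\theta^{s+d}\,J_{s,d}\left(\int_{\mathbb{R}^d}f^{\frac{d}{d+r}}\,d\lambda_d\right)^{s/d}\int_{\{f>0\}}f_{\theta,\mu}\,f^{-\frac{s}{d+r}}\,d\lambda_d .$$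
   Context: $|\cdot|$ is a norm on $\mathbb{R}^d$, and $d(x,\alpha)=\min_{a\in\alpha}|x-a|$ for a finite nonempty $\alpha\subset\mathbb{R}^d$. $\widehat X^{\alpha}$ denotes a Voronoi quantization (nearest-neighbour projection) of $X$ on $\alpha$, so $\|X-\widehat X^{\alpha}\|_s^s=\mathbb{E}\,d(X,\alpha)^s=\int d(x,\alpha)^s\,dP(x)$. A sequence of quantizers $(\alpha_n)_{n\ge1}$ is a sequence of finite nonempty sets $\alpha_n\subset\mathbb{R}^d$ with $\mathrm{card}(\alpha_n)\le n$. For a probability $P$ put $e_{n,r}(P)=\inf_{\mathrm{card}(\alpha)\le n}\left(\int d(x,\alpha)^r dP(x)\right)^{1/r}$. $J_{r,d}=\inf_{n\ge1}n^{r/d}e_{n,r}^r(U([0,1]^d))\in(0,\infty)$, where $U([0,1]^d)$ is the uniform distribution on $[0,1]^d$, and $Q_r(P)=J_{r,d}\left(\int f^{d/(d+r)}d\lambda_d\right)^{(d+r)/d}$, where $f$ is the density of the absolutely continuous part of $P$. The sequence $(\alpha_n)$ is asymptotically $L^r(P)$-optimal if $\lim_n n^{r/d}\int d(x,\alpha_n)^r dP(x)=Q_r(P)$. For $\theta>0$, $\mu\in\mathbb{R}^d$: $\alpha_n^{\theta,\mu}=\{\mu+\theta(a-\mu):a\in\alpha_n\}$ and $f_{\theta,\mu}(x)=f(\mu+\theta(x-\mu))$. *)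

theory Defs
  imports "HOL-Probability.Probability"
begin

definition is_norm :: "('a::real_vector \<Rightarrow> real) \<Rightarrow> bool" where
  "is_norm N \<longleftrightarrow>
     (\<forall>x. 0 \<le> N x) \<and> (\<forall>x. N x = 0 \<longleftrightarrow> x = 0) \<and>
     (\<forall>c x. N (c *\<^sub>R x) = \<bar>c\<bar> * N x) \<and> (\<forall>x y. N (x + y) \<le> N x + N y)"

(* Power of an extended nonnegative real; only used with exponents p > 0,
   where 0^p = 0 and \<infinity>^p = \<infinity>. *)
definition enn_powr :: "ennreal \<Rightarrow> real \<Rightarrow> ennreal" where
  "enn_powr x p = (if x = \<infinity> then \<infinity> else ennreal (enn2real x powr p))"

definition mutually_singular :: "'a measure \<Rightarrow> 'a measure \<Rightarrow> bool" where
  "mutually_singular \<mu> \<nu> \<longleftrightarrow>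
     (\<exists>A \<in> sets \<mu>. emeasure \<mu> A = 0 \<and> emeasure \<nu> (space \<nu> - A) = 0)"

(* The measure with density f is the absolutely continuous part of P in its Lebesgue
   decomposition: f is a Borel version of the density, with values in [0, \<infinity>). *)
definition ac_part_density ::
    "'a::euclidean_space measure \<Rightarrow> ('a \<Rightarrow> real) \<Rightarrow> bool" where
  "ac_part_density P f \<longleftrightarrow>
     f \<in> borel_measurable borel \<and> (\<forall>x. 0 \<le> f x) \<and>
     (\<exists>S. sets S = sets borel \<and> mutually_singular lborel S \<and>
        (\<forall>A \<in> sets borel. emeasure P A = emeasure (density lborel (\<lambda>x. ennreal (f x))) A + emeasure S A))"

definition set_dist :: "('a::real_vector \<Rightarrow> real) \<Rightarrow> 'a \<Rightarrow> 'a set \<Rightarrow> real" where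
  "set_dist N x \<alpha> = Min ((\<lambda>a. N (x - a)) ` \<alpha>)"

definition quantizer :: "nat \<Rightarrow> 'a set \<Rightarrow> bool" where
  "quantizer n \<alpha> \<longleftrightarrow> finite \<alpha> \<and> \<alpha> \<noteq> {} \<and> card \<alpha> \<le> n"

(* Y is a Voronoi quantization of X on \<alpha>: the image of X under a Borel
   nearest-neighbour projection (ties between nearest points broken arbitrarily). *)
definition voronoi_quantization ::
    "('a::euclidean_space \<Rightarrow> real) \<Rightarrow> 'a set \<Rightarrow> ('w \<Rightarrow> 'a) \<Rightarrow> ('w \<Rightarrow> 'a) \<Rightarrow> bool" where
  "voronoi_quantization N \<alpha> X Y \<longleftrightarrow>
     (\<exists>p \<in> borel_measurable borel.
        (\<forall>x. p x \<in> \<alpha> \<and> N (x - p x) = set_dist N x \<alpha>) \<and> Y = p \<circ> X)"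

definition Ls_norm ::
    "('a \<Rightarrow> real) \<Rightarrow> 'w measure \<Rightarrow> real \<Rightarrow> ('w \<Rightarrow> 'a) \<Rightarrow> ennreal" where
  "Ls_norm N M s Z = enn_powr (\<integral>\<^sup>+\<omega>. ennreal (N (Z \<omega>) powr s) \<partial>M) (1 / s)"

definition distortion ::
    "('a::euclidean_space \<Rightarrow> real) \<Rightarrow> real \<Rightarrow> 'a measure \<Rightarrow> 'a set \<Rightarrow> ennreal" where
  "distortion N r P \<alpha> = (\<integral>\<^sup>+x. ennreal (set_dist N x \<alpha> powr r) \<partial>P)"

definition quant_error ::
    "('a::euclidean_space \<Rightarrow> real) \<Rightarrow> nat \<Rightarrow> real \<Rightarrow> 'a measure \<Rightarrow> ennreal" where
  "quant_error N n r P = (INF \<alpha> \<in> {\<alpha>. quantizer n \<alpha>}. enn_powr (distortion N r P \<alpha>) (1 / r))"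

(* J_{r,d}. The dimension d = CARD('n) is carried by the type of the norm N, and
   cbox 0 1 is the unit cube [0,1]^d. *)
definition quant_const :: "(real ^ 'n \<Rightarrow> real) \<Rightarrow> real \<Rightarrow> ennreal" where
  "quant_const N r =
     (INF n \<in> {1::nat..}. ennreal (real n powr (r / real CARD('n))) *
        enn_powr (quant_error N n r (uniform_measure lborel (cbox 0 1))) r)"

(* Q_r(P), as a function of the density f of the absolutely continuous part of P. *)
definition Q_const :: "(real ^ 'n \<Rightarrow> real) \<Rightarrow> real \<Rightarrow> (real ^ 'n \<Rightarrow> real) \<Rightarrow> ennreal" where
  "Q_const N r f =
     quant_const N r *
     enn_powr (\<integral>\<^sup>+x. ennreal (f x powr (real CARD('n) / (real CARD('n) + r))) \<partial>lborel)
       ((real CARD('n) + r) / real CARD('n))"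

definition asymp_optimal ::
    "(real ^ 'n \<Rightarrow> real) \<Rightarrow> real \<Rightarrow> (real ^ 'n) measure \<Rightarrow> (real ^ 'n \<Rightarrow> real) \<Rightarrow>
     (nat \<Rightarrow> (real ^ 'n) set) \<Rightarrow> bool" where
  "asymp_optimal N r P f \<alpha> \<longleftrightarrow>
     (\<lambda>n. ennreal (real n powr (r / real CARD('n))) * distortion N r P (\<alpha> n))
       \<longlonglongrightarrow> Q_const N r f"

definition dilate :: "real \<Rightarrow> 'a::real_vector \<Rightarrow> 'a \<Rightarrow> 'a" where
  "dilate \<theta> \<mu> x = \<mu> + \<theta> *\<^sub>R (x - \<mu>)"

definition Q_Inf ::
    "(real ^ 'n \<Rightarrow> real) \<Rightarrow> real \<Rightarrow> real \<Rightarrow> (real ^ 'n \<Rightarrow> real) \<Rightarrow> real \<Rightarrow> real ^ 'n \<Rightarrow> ennreal" where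
  "Q_Inf N r s f \<theta> \<mu> =
     ennreal (\<theta> powr (s + real CARD('n))) * quant_const N s *
     enn_powr (\<integral>\<^sup>+x. ennreal (f x powr (real CARD('n) / (real CARD('n) + r))) \<partial>lborel)
       (s / real CARD('n)) *
     (\<integral>\<^sup>+x \<in> {x. 0 < f x}.
        ennreal (f (dilate \<theta> \<mu> x) * f x powr (- (s / (real CARD('n) + r)))) \<partial>lborel)"

end

theory Submission
  imports Defs "HOL-Real_Asymp.Real_Asymp"
begin

text \<open>
  Write \<open>d\<close> for the dimension, \<open>I\<close> for the integral of \<open>f powr (d / (d + r))\<close> and \<open>w\<close> for the probability
  density \<open>f powr (d / (d + r)) / I\<close>. Distances from \<open>\<mu> + \<theta> (z - \<mu>)\<close> to the dilated quantizer are \<open>\<theta>\<close>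
  times the distances from \<open>z\<close> to \<open>\<alpha> n\<close>; so after dropping the singular part of \<open>P\<close>, a change of variables
  reduces the claim to a statement on the original quantizers: for every integrable \<open>g \<ge> 0\<close> the lower limit
  of \<open>n powr (s / d) * \<integral> g(x) d(x, \<alpha> n) powr s dx\<close> is at least \<open>J * \<integral> g * w powr (- (s / d))\<close>, the second
  integral being over \<open>{f > 0}\<close> and \<open>J\<close> being the quantization constant for \<open>s\<close>
  (\<open>mismatched_distortion_lower_bound\<close>). Heuristically, optimal quantizers put about \<open>n * w(x)\<close> points per
  unit volume near \<open>x\<close>, and with \<open>n * u\<close> points per unit volume the \<open>s\<close>-th power of the distance is, on
  average, at least \<open>J * (n * u) powr (- (s / d))\<close>.

  The second half of the heuristics is a bound for single cubes (\<open>cube_lower_bound\<close>), obtained from the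
  definition of \<open>J\<close> by scaling once the points outside the cube have been replaced by a coarse grid inside.
  Averaging it over all positions of a cube of side \<open>h\<close>, with weight \<open>g\<close>, gives a bound in terms of a smoothed
  density \<open>u\<close> of the points, whose total mass is at most 1 (\<open>averaged_lower_bound\<close>). Because the cube bound holds for
  distances truncated at a multiple of \<open>n powr (- 1 / d)\<close>, the passage from \<open>g\<close> to its averages only costs an
  \<open>L\<^sup>1\<close> error, which vanishes with \<open>h\<close> (\<open>cube_average_L1_tendsto\<close>).

  The first half comes from the same bound with \<open>f\<close> and \<open>r\<close> in place of \<open>g\<close> and \<open>s\<close>. Asymptotic optimality says
  that the rescaled distortion tends to the quantization constant for \<open>r\<close> times the minimum, given by Hoelder's
  inequality, of
  \<open>\<integral> f * u powr (- (r / d))\<close> over densities \<open>u\<close> of mass at most 1. The minimizer is \<open>w\<close>, and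
  \<open>stability_of_optimal_density\<close> is a quantitative version of the equality case: densities with almost minimal
  value converge to \<open>w\<close>, almost everywhere on \<open>{f > 0}\<close> along a subsequence. Fatou's lemma
  then finishes the argument.

  Two facts make this meaningful: the quantization constants are positive and finite (\<open>quant_const_pos\<close>,
  \<open>quant_const_finite\<close>), and \<open>I\<close> is finite by the moment condition (\<open>nn_integral_density_powr_finite\<close>).
\<close>

section \<open>Norms and distances to finite sets\<close>

lemma is_norm_lipschitz:
  fixes N :: "'a::real_normed_vector \<Rightarrow> real"
  assumes "is_norm N" and "0 \<le> C" and le: "\<And>x. N x \<le> C * norm x"
  shows "lipschitz_on C UNIV N"
proof (rule lipschitz_onI)
  fix x y
  have tri: "N (a + b) \<le> N a + N b" for a b
    using assms(1) unfolding is_norm_def by auto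
  show "dist (N x) (N y) \<le> C * dist x y"
    using tri[of "x - y" y] tri[of "y - x" x] le[of "x - y"] le[of "y - x"]
    by (auto simp: dist_real_def dist_norm norm_minus_commute abs_le_iff)
qed fact

text \<open>
  The local estimates compare balls of the norm with cubes; the constants \<open>lo\<close> and \<open>hi\<close> of this
  comparison are fixed once, since the number of auxiliary grid points depends on them.
\<close>
locale comparable_norm =
  fixes N :: "real ^ 'n \<Rightarrow> real" and lo hi :: real
  assumes is_norm: "is_norm N"
    and lo_pos: "0 < lo" and hi_pos: "0 < hi"
    and lo_le: "lo * \<bar>x $ i\<bar> \<le> N x"
    and le_hi: "(\<And>i. \<bar>x $ i\<bar> \<le> \<rho>) \<Longrightarrow> N x \<le> hi * \<rho>"
begin

lemma N_nonneg [simp]: "0 \<le> N x"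
  and N_eq_0_iff [simp]: "N x = 0 \<longleftrightarrow> x = 0"
  and N_scaleR: "N (c *\<^sub>R x) = \<bar>c\<bar> * N x"
  and N_triangle: "N (x + y) \<le> N x + N y"
  using is_norm unfolding is_norm_def by auto

lemma N_le_norm: "N x \<le> hi * norm x"
  by (rule le_hi) (use component_le_norm_cart in auto)

lemma continuous_on_N: "continuous_on UNIV N"
  by (rule lipschitz_on_continuous_on[OF is_norm_lipschitz[OF is_norm _ N_le_norm]]) (use hi_pos in simp)

lemma measurable_N [measurable]: "N \<in> borel_measurable borel"
  by (rule borel_measurable_continuous_onI[OF continuous_on_N])

lemma set_dist_le: "finite \<alpha> \<Longrightarrow> a \<in> \<alpha> \<Longrightarrow> set_dist N x \<alpha> \<le> N (x - a)"
  unfolding set_dist_def by auto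

lemma set_dist_attained:
  assumes "finite \<alpha>" "\<alpha> \<noteq> {}"
  obtains a where "a \<in> \<alpha>" "set_dist N x \<alpha> = N (x - a)"
proof -
  have "set_dist N x \<alpha> \<in> (\<lambda>a. N (x - a)) ` \<alpha>"
    unfolding set_dist_def using assms by (intro Min_in) auto
  then show ?thesis
    using that by auto
qed

lemma set_dist_nonneg: "finite \<alpha> \<Longrightarrow> \<alpha> \<noteq> {} \<Longrightarrow> 0 \<le> set_dist N x \<alpha>"
  by (metis N_nonneg set_dist_attained)

lemma measurable_set_dist [measurable (raw)]:
  assumes "finite \<alpha>" "\<alpha> \<noteq> {}"
  shows "(\<lambda>x. set_dist N x \<alpha>) \<in> borel_measurable borel"
  using assms
proof (induction \<alpha> rule: finite_ne_induct)
  case (singleton a)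
  show ?case unfolding set_dist_def by simp
next
  case (insert a F)
  have *: "(\<lambda>x. set_dist N x (insert a F)) = (\<lambda>x. min (N (x - a)) (set_dist N x F))"
    using insert unfolding set_dist_def by (auto simp: fun_eq_iff)
  show ?case
    unfolding * using insert by measurable
qed

lemma set_dist_affine:
  assumes "finite \<alpha>" "\<alpha> \<noteq> {}" "0 < c"
  shows "set_dist N (t + c *\<^sub>R x) ((\<lambda>y. t + c *\<^sub>R y) ` \<alpha>) = c * set_dist N x \<alpha>"
proof -
  have mono: "mono ((*) c)"
    using assms by (auto simp: mono_def)
  have "N (t + c *\<^sub>R x - (t + c *\<^sub>R a)) = c * N (x - a)" for a
    using N_scaleR[of c "x - a"] assms by (simp add: algebra_simps)
  then have "set_dist N (t + c *\<^sub>R x) ((\<lambda>y. t + c *\<^sub>R y) ` \<alpha>) = Min ((*) c ` ((\<lambda>a. N (x - a)) ` \<alpha>))"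
    unfolding set_dist_def by (simp add: image_image)
  also have "\<dots> = c * set_dist N x \<alpha>"
    unfolding set_dist_def using assms by (subst mono_Min_commute[OF mono]) auto
  finally show ?thesis .
qed

end

text \<open>
  The lower constant is the minimum of the norm on the Euclidean unit sphere, which is attained
  because the norm is Lipschitz.
\<close>
lemma is_norm_imp_comparable:
  fixes N :: "real ^ 'n \<Rightarrow> real"
  assumes "is_norm N"
  obtains lo hi where "comparable_norm N lo hi"
proof -
  have nn: "0 \<le> N x" and z: "N x = 0 \<longleftrightarrow> x = 0" and sc: "N (c *\<^sub>R x) = \<bar>c\<bar> * N x"
    and tri: "N (x + y) \<le> N x + N y" for x y c
    using assms unfolding is_norm_def by auto
  have Nsum: "N (\<Sum>b\<in>B. g b) \<le> (\<Sum>b\<in>B. N (g b))" if "finite B" for B and g :: "real ^ 'n \<Rightarrow> real ^ 'n"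
    using that
  proof (induction B)
    case (insert b B)
    then show ?case using tri[of "g b" "sum g B"] by simp
  qed (use z[of 0] in simp)
  define hi where "hi = 1 + (\<Sum>b\<in>(Basis :: (real ^ 'n) set). N b)"
  have hi: "0 < hi"
    unfolding hi_def using sum_nonneg[of Basis N] nn by (simp add: add_pos_nonneg)
  have le_hi: "N x \<le> hi * \<rho>" if "\<And>i. \<bar>x $ i\<bar> \<le> \<rho>" for x \<rho>
  proof -
    have \<rho>: "0 \<le> \<rho>" using that[of undefined] by linarith
    have "N x = N (\<Sum>b\<in>Basis. (x \<bullet> b) *\<^sub>R b)"
      by (simp add: euclidean_representation)
    also have "\<dots> \<le> (\<Sum>b\<in>Basis. \<bar>x \<bullet> b\<bar> * N b)"
      using Nsum[of Basis "\<lambda>b. (x \<bullet> b) *\<^sub>R b"] by (simp add: sc)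
    also have "\<dots> \<le> (\<Sum>b\<in>Basis. \<rho> * N b)"
    proof (intro sum_mono mult_right_mono nn)
      fix b :: "real ^ 'n" assume "b \<in> Basis"
      then obtain i where "b = axis i 1" by (auto simp: Basis_vec_def)
      then show "\<bar>x \<bullet> b\<bar> \<le> \<rho>" using that by (simp add: inner_axis)
    qed
    also have "\<dots> \<le> hi * \<rho>"
      unfolding hi_def using \<rho> by (simp add: sum_distrib_left algebra_simps)
    finally show ?thesis .
  qed
  have Nnorm: "N x \<le> hi * norm x" for x
    by (rule le_hi) (use component_le_norm_cart in auto)
  have "lipschitz_on hi UNIV N"
    using is_norm_lipschitz[OF assms] hi Nnorm by auto
  then have cont: "continuous_on (sphere 0 1) N"
    by (meson lipschitz_on_continuous_on continuous_on_subset subset_UNIV)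
  have "sphere (0 :: real ^ 'n) 1 \<noteq> {}"
    by simp
  then obtain x0 where x0: "x0 \<in> sphere 0 1" "\<And>x. x \<in> sphere 0 1 \<Longrightarrow> N x0 \<le> N x"
    using continuous_attains_inf[OF compact_sphere _ cont] by blast
  define lo where "lo = N x0"
  have "x0 \<noteq> 0" using x0 by auto
  then have lo: "0 < lo"
    unfolding lo_def using nn[of x0] z[of x0] by linarith
  have lo_le: "lo * \<bar>x $ i\<bar> \<le> N x" for x i
  proof (cases "x = 0")
    case False
    then have "lo \<le> N (x /\<^sub>R norm x)"
      unfolding lo_def by (intro x0) auto
    also have "\<dots> = N x / norm x"
      by (simp add: sc divide_inverse mult.commute)
    finally have "lo * norm x \<le> N x"
      using False by (simp add: field_simps)
    moreover have "lo * \<bar>x $ i\<bar> \<le> lo * norm x"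
      using lo component_le_norm_cart[of x i] by simp
    ultimately show ?thesis by linarith
  qed (simp add: nn)
  show ?thesis
    by (rule that, rule comparable_norm.intro) (fact assms lo hi lo_le le_hi)+
qed

section \<open>Cubes\<close>

lemma sum_Basis_eq_1: "\<Sum>Basis = (1 :: real ^ 'n)"
proof (rule euclidean_eqI)
  fix b :: "real ^ 'n" assume b: "b \<in> Basis"
  then obtain i where "b = axis i 1" by (auto simp: Basis_vec_def)
  then have "(1 :: real ^ 'n) \<bullet> b = 1"
    by (simp add: inner_axis)
  with inner_sum_Basis[OF b] show "\<Sum>Basis \<bullet> b = (1 :: real ^ 'n) \<bullet> b"
    by (simp only:)
qed

lemma cube_iff:
  "x \<in> cbox a (a + h *\<^sub>R (1 :: real ^ 'n)) \<longleftrightarrow> (\<forall>i. a $ i \<le> x $ i \<and> x $ i \<le> a $ i + h)"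
  by (simp add: mem_box_cart)

lemma emeasure_cube:
  fixes a :: "real ^ 'n"
  assumes "0 \<le> h"
  shows "emeasure lborel (cbox a (a + h *\<^sub>R 1)) = ennreal (h ^ CARD('n))"
proof -
  have [simp]: "b \<in> Basis \<Longrightarrow> (1 :: real ^ 'n) \<bullet> b = 1" for b
    by (simp flip: sum_Basis_eq_1)
  show ?thesis
    using assms by (subst emeasure_lborel_cbox) (auto simp: inner_add_left)
qed

lemma nn_integral_lborel_affine:
  fixes F :: "real ^ 'n \<Rightarrow> ennreal"
  assumes [measurable]: "F \<in> borel_measurable borel" and "0 < c"
  shows "(\<integral>\<^sup>+x. F x \<partial>lborel) = ennreal (c ^ CARD('n)) * (\<integral>\<^sup>+x. F (t + c *\<^sub>R x) \<partial>lborel)"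
  using assms(2)
  by (subst lborel_affine[of c t])
     (auto simp: nn_integral_density nn_integral_distr nn_integral_cmult ennreal_power)

section \<open>The quantization constant of the cube\<close>

lemma enn_powr_ennreal: "0 \<le> x \<Longrightarrow> enn_powr (ennreal x) p = ennreal (x powr p)"
  unfolding enn_powr_def by simp

lemma enn_powr_mono:
  assumes "x \<le> y" "0 \<le> p"
  shows "enn_powr x p \<le> enn_powr y p"
proof (cases "y = \<infinity>")
  case False
  then obtain v where v: "y = ennreal v" "0 \<le> v"
    by (cases y) auto
  moreover obtain u where "x = ennreal u" "0 \<le> u"
    using assms v by (cases x) (auto simp: top_unique)
  ultimately show ?thesis
    using assms by (auto simp: enn_powr_ennreal intro!: powr_mono2 ennreal_leI)
qed (simp add: enn_powr_def)

lemma enn_powr_powr: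
  assumes "p * q = 1"
  shows "enn_powr (enn_powr x p) q = x"
proof (cases "x = \<infinity>")
  case False
  then obtain u where "x = ennreal u" "0 \<le> u"
    by (cases x) auto
  with assms show ?thesis
    by (simp add: enn_powr_ennreal powr_powr)
qed (simp add: enn_powr_def)

abbreviation unit_cube_measure :: "(real ^ 'n) measure" where
  "unit_cube_measure \<equiv> uniform_measure lborel (cbox 0 1)"

lemma emeasure_unit_cube: "emeasure lborel (cbox 0 (1 :: real ^ 'n)) = 1"
  using emeasure_cube[of 1 "0 :: real ^ 'n"] by simp

lemma nn_integral_unit_cube_measure:
  fixes F :: "real ^ 'n \<Rightarrow> ennreal"
  assumes [measurable]: "F \<in> borel_measurable borel"
  shows "(\<integral>\<^sup>+x. F x \<partial>unit_cube_measure) = (\<integral>\<^sup>+x. F x * indicator (cbox 0 1) x \<partial>lborel)"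
  by (subst nn_integral_uniform_measure) (simp_all add: emeasure_unit_cube divide_ennreal_def)

text \<open>
  This, applied to rescaled cubes, is the only way in which \<open>quant_const\<close> enters the lower bounds for distortions:
  being an infimum over all \<open>n\<close>, it bounds the distortion of the cube for every finite number of
  points, not only asymptotically.
\<close>
lemma quant_const_le:
  fixes N :: "real ^ 'n \<Rightarrow> real" and s :: real
  assumes "0 < s" "quantizer n \<beta>" "1 \<le> n"
  shows "quant_const N s \<le> ennreal (real n powr (s / CARD('n))) * distortion N s unit_cube_measure \<beta>"
proof -
  have "quant_const N s \<le> ennreal (real n powr (s / CARD('n))) * enn_powr (quant_error N n s unit_cube_measure) s"
    unfolding quant_const_def using assms by (intro INF_lower) auto
  also have "enn_powr (quant_error N n s unit_cube_measure) s
      \<le> enn_powr (enn_powr (distortion N s unit_cube_measure \<beta>) (1 / s)) s"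
    unfolding quant_error_def using assms by (intro enn_powr_mono INF_lower) auto
  also have "\<dots> = distortion N s unit_cube_measure \<beta>"
    using assms by (intro enn_powr_powr) simp
  finally show ?thesis
    by (simp add: mult_left_mono)
qed

lemma le_quant_const:
  fixes N :: "real ^ 'n \<Rightarrow> real" and s :: real
  assumes "0 < s"
    and le: "\<And>n \<beta>. 1 \<le> n \<Longrightarrow> quantizer n \<beta> \<Longrightarrow>
      C \<le> ennreal (real n powr (s / CARD('n))) * distortion N s unit_cube_measure \<beta>"
  shows "C \<le> quant_const N s"
  unfolding quant_const_def
proof (rule INF_greatest)
  fix n :: nat assume "n \<in> {1..}"
  then have n: "1 \<le> n" by simp
  define \<nu> where "\<nu> = ennreal (real n powr (s / CARD('n)))"
  have \<nu>: "\<nu> \<noteq> 0" "\<nu> \<noteq> \<infinity>"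
    using n by (auto simp: \<nu>_def)
  have "C / \<nu> \<le> distortion N s unit_cube_measure \<beta>" if "quantizer n \<beta>" for \<beta>
    using le[OF n that] \<nu> unfolding \<nu>_def[symmetric]
    by (intro divide_le_posI_ennreal) (auto simp: mult.commute zero_less_iff_neq_zero)
  then have "enn_powr (C / \<nu>) (1 / s) \<le> quant_error N n s unit_cube_measure"
    unfolding quant_error_def using assms by (intro INF_greatest enn_powr_mono) auto
  then have "enn_powr (enn_powr (C / \<nu>) (1 / s)) s \<le> enn_powr (quant_error N n s unit_cube_measure) s"
    using assms by (intro enn_powr_mono) auto
  then have "C / \<nu> \<le> enn_powr (quant_error N n s unit_cube_measure) s"
    using assms by (subst (asm) enn_powr_powr) auto
  then have "\<nu> * (C / \<nu>) \<le> \<nu> * enn_powr (quant_error N n s unit_cube_measure) s"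
    by (rule mult_left_mono) simp
  moreover have "\<nu> * (C / \<nu>) = C"
    using \<nu> by (metis ennreal_times_divide mult_divide_eq_ennreal mult.commute infinity_ennreal_def)
  ultimately show "C \<le> ennreal (real n powr (s / CARD('n))) * enn_powr (quant_error N n s unit_cube_measure) s"
    by (simp add: \<nu>_def)
qed

context comparable_norm
begin

lemma quant_const_finite:
  fixes s :: real
  assumes "0 < s"
  shows "quant_const N s < \<infinity>"
proof -
  have "quant_const N s \<le> distortion N s unit_cube_measure {0}"
    using quant_const_le[OF assms, of 1 "{0}" N] by (simp add: quantizer_def)
  also have "\<dots> = (\<integral>\<^sup>+x. ennreal (N x powr s) * indicator (cbox 0 1) x \<partial>lborel)"
    unfolding distortion_def by (subst nn_integral_unit_cube_measure) (auto simp: set_dist_def)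
  also have "\<dots> \<le> (\<integral>\<^sup>+x. ennreal (hi powr s) * indicator (cbox 0 (1 :: real ^ 'n)) x \<partial>lborel)"
  proof (rule nn_integral_mono)
    fix x :: "real ^ 'n"
    have "N x powr s \<le> hi powr s" if "x \<in> cbox 0 1"
      using that le_hi[of x 1] assms by (intro powr_mono2) (auto simp: mem_box_cart)
    then show "ennreal (N x powr s) * indicator (cbox 0 1) x \<le> ennreal (hi powr s) * indicator (cbox 0 1) x"
      by (auto split: split_indicator)
  qed
  also have "\<dots> < \<infinity>"
    by (simp add: nn_integral_cmult_indicator emeasure_unit_cube)
  finally show ?thesis .
qed

text \<open>
  The points at distance less than \<open>t\<close> from one of the \<open>n\<close> points of a quantizer lie in \<open>n\<close> cubes of
  side \<open>2 t / lo\<close>. For \<open>t\<close> of order \<open>n powr (- 1 / d)\<close> these cover at most half of the unit cube, and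
  on the other half the distance is at least \<open>t\<close>. Positivity is what turns optimality of the
  quantizers into information on the location of their points.
\<close>
lemma quant_const_pos:
  fixes s :: real
  assumes "0 < s"
  shows "0 < quant_const N s"
proof -
  define d where "d = CARD('n)"
  have d: "0 < d" unfolding d_def by simp
  (* chosen such that n cubes of side 2 t / lo with t = \<tau> n^(-1/d) have total volume 1/2 *)
  define \<tau> where "\<tau> = lo / 2 * (1/2) powr (1 / d)"
  have \<tau>: "0 < \<tau>" "(2 * \<tau> / lo) ^ d = 1 / 2"
    using lo_pos d by (auto simp: \<tau>_def powr_realpow[symmetric] powr_powr)
  have "ennreal (\<tau> powr s / 2) \<le> quant_const N s"
  proof (rule le_quant_const[OF assms])
    fix n :: nat and \<beta> :: "(real ^ 'n) set"
    assume n: "1 \<le> n" and q: "quantizer n \<beta>"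
    then have \<beta>: "finite \<beta>" "\<beta> \<noteq> {}" "card \<beta> \<le> n"
      unfolding quantizer_def by auto
    define t where "t = \<tau> * real n powr (- 1 / d)"
    have t: "0 < t" using \<tau> n by (simp add: t_def)
    define U where "U = (\<Union>b\<in>\<beta>. cbox (b - (t / lo) *\<^sub>R 1) (b - (t / lo) *\<^sub>R 1 + (2 * t / lo) *\<^sub>R 1))"
    have U [measurable]: "U \<in> sets borel"
      unfolding U_def using \<beta> by (intro sets.finite_UN) auto
    have "emeasure lborel U \<le> (\<Sum>b\<in>\<beta>. ennreal ((2 * t / lo) ^ d))"
      unfolding U_def d_def using \<beta> t lo_pos
      by (intro order_trans[OF emeasure_subadditive_finite] sum_mono)
         (auto simp: emeasure_cube simp del: scaleR_right_diff_distrib)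
    also have "\<dots> \<le> of_nat n * ennreal ((2 * t / lo) ^ d)"
      using \<beta> by (simp add: mult_right_mono)
    also have "\<dots> = ennreal (real n * (2 * t / lo) ^ d)"
      using t lo_pos by (simp add: ennreal_mult ennreal_of_nat_eq_real_of_nat)
    also have "(2 * t / lo) ^ d = (2 * \<tau> / lo) ^ d * (real n powr (- 1 / d)) ^ d"
      by (simp add: t_def power_mult_distrib power_divide field_simps)
    also have "(real n powr (- 1 / d)) ^ d = 1 / real n"
      using n d by (subst powr_realpow[symmetric], simp, subst powr_powr) (simp add: powr_minus_divide)
    finally have eU: "emeasure lborel U \<le> ennreal (1/2)"
      using n \<tau> by simp
    have "1 = emeasure lborel (cbox 0 (1 :: real ^ 'n))"
      by (simp add: emeasure_unit_cube)
    also have "\<dots> \<le> emeasure lborel (cbox 0 1 - U) + emeasure lborel U"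
      by (intro order_trans[OF _ emeasure_subadditive] emeasure_mono) auto
    also have "\<dots> \<le> emeasure lborel (cbox 0 1 - U) + ennreal (1/2)"
      using eU by (rule add_left_mono)
    finally have one_le: "1 \<le> emeasure lborel (cbox 0 (1 :: real ^ 'n) - U) + ennreal (1/2)" .
    have half: "ennreal (1/2) \<le> emeasure lborel (cbox 0 (1 :: real ^ 'n) - U)"
    proof (cases "emeasure lborel (cbox 0 (1 :: real ^ 'n) - U)")
      case (real e)
      then have "ennreal 1 \<le> ennreal (e + 1/2)"
        using one_le by (subst ennreal_plus) auto
      then have "1 \<le> e + 1/2"
        by (subst (asm) ennreal_le_iff) (use real in auto)
      then have "1/2 \<le> e"
        by simp
      then show ?thesis
        unfolding real by (rule ennreal_leI)
    qed simp
    have far: "t \<le> set_dist N x \<beta>" if "x \<notin> U" for x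
    proof -
      obtain b where b: "b \<in> \<beta>" "set_dist N x \<beta> = N (x - b)"
        using set_dist_attained \<beta> by metis
      then have "x \<notin> cbox (b - (t / lo) *\<^sub>R 1) (b - (t / lo) *\<^sub>R 1 + (2 * t / lo) *\<^sub>R 1)"
        using that unfolding U_def by blast
      then obtain i where "\<not> (b $ i - t / lo \<le> x $ i \<and> x $ i \<le> b $ i - t / lo + 2 * (t / lo))"
        unfolding cube_iff by auto
      then have "t / lo < \<bar>(x - b) $ i\<bar>"
        by auto
      then have "t \<le> lo * \<bar>(x - b) $ i\<bar>"
        using lo_pos by (simp add: field_simps)
      with lo_le[of "x - b" i] b show ?thesis by simp
    qed
    have "ennreal (t powr s / 2) \<le> ennreal (t powr s) * emeasure lborel (cbox 0 (1 :: real ^ 'n) - U)"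
    proof -
      have "ennreal (t powr s / 2) = ennreal (t powr s) * ennreal (1/2)"
        by (subst ennreal_mult[symmetric]) auto
      also have "\<dots> \<le> ennreal (t powr s) * emeasure lborel (cbox 0 (1 :: real ^ 'n) - U)"
        by (intro mult_left_mono half) simp
      finally show ?thesis .
    qed
    also have "\<dots> = (\<integral>\<^sup>+x. ennreal (t powr s) * indicator (cbox 0 (1 :: real ^ 'n) - U) x \<partial>lborel)"
      by (simp add: nn_integral_cmult_indicator)
    also have "\<dots> \<le> (\<integral>\<^sup>+x. ennreal (set_dist N x \<beta> powr s) * indicator (cbox 0 1) x \<partial>lborel)"
    proof (rule nn_integral_mono)
      fix x :: "real ^ 'n"
      have "t powr s \<le> set_dist N x \<beta> powr s" if "x \<notin> U"
        using far[OF that] t assms by (intro powr_mono2) auto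
      then show "ennreal (t powr s) * indicator (cbox 0 1 - U) x
          \<le> ennreal (set_dist N x \<beta> powr s) * indicator (cbox 0 1) x"
        by (auto split: split_indicator)
    qed
    also have "\<dots> = distortion N s unit_cube_measure \<beta>"
      unfolding distortion_def using \<beta> by (subst nn_integral_unit_cube_measure) auto
    finally have "ennreal (real n powr (s / d)) * ennreal (t powr s / 2)
        \<le> ennreal (real n powr (s / d)) * distortion N s unit_cube_measure \<beta>"
      by (rule mult_left_mono) simp
    moreover have "real n powr (s / d) * (t powr s / 2) = \<tau> powr s / 2"
      unfolding t_def using n \<tau>(1)
      by (subst powr_mult, simp, simp, subst powr_powr) (simp add: powr_minus field_simps)
    ultimately show "ennreal (\<tau> powr s / 2)
        \<le> ennreal (real n powr (s / CARD('n))) * distortion N s unit_cube_measure \<beta>"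
      by (simp add: d_def flip: ennreal_mult)
  qed
  moreover have "0 < ennreal (\<tau> powr s / 2)"
    using \<tau> by simp
  ultimately show ?thesis by (rule less_le_trans[rotated])
qed

end

section \<open>Local lower bounds on cubes\<close>

context comparable_norm
begin

lemma cube_grid:
  fixes a :: "real ^ 'n"
  assumes "0 < \<rho>" "0 \<le> h"
  obtains G where "finite G" "G \<noteq> {}" "real (card G) \<le> (h / \<rho> + 1) ^ CARD('n)"
    "\<And>x. x \<in> cbox a (a + h *\<^sub>R 1) \<Longrightarrow> \<exists>g\<in>G. N (x - g) \<le> hi * \<rho>"
proof -
  define K where "K = nat \<lfloor>h / \<rho>\<rfloor>"
  define p where "p = (\<lambda>j :: 'n \<Rightarrow> nat. \<chi> i. a $ i + \<rho> * real (j i))"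
  define G where "G = p ` (UNIV \<rightarrow>\<^sub>E {..K})"
  have fin: "finite (UNIV \<rightarrow>\<^sub>E {..K} :: ('n \<Rightarrow> nat) set)"
    by (intro finite_PiE) auto
  have "card G \<le> card (UNIV \<rightarrow>\<^sub>E {..K} :: ('n \<Rightarrow> nat) set)"
    unfolding G_def by (rule card_image_le[OF fin])
  also have "\<dots> = (K + 1) ^ CARD('n)"
    by (subst card_PiE) auto
  finally have "real (card G) \<le> (real K + 1) ^ CARD('n)"
    by (metis of_nat_1 of_nat_add of_nat_le_iff of_nat_power)
  also have "\<dots> \<le> (h / \<rho> + 1) ^ CARD('n)"
    using assms by (intro power_mono) (auto simp: K_def)
  finally have card: "real (card G) \<le> (h / \<rho> + 1) ^ CARD('n)" .
  have near: "\<exists>g\<in>G. N (x - g) \<le> hi * \<rho>" if x: "x \<in> cbox a (a + h *\<^sub>R 1)" for x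
  proof
    define q where "q = (\<lambda>i. (x $ i - a $ i) / \<rho>)"
    have q: "0 \<le> q i" "q i \<le> h / \<rho>" for i
      using x assms unfolding cube_iff q_def by (auto intro!: divide_right_mono simp: algebra_simps)
    define j where "j = (\<lambda>i. nat \<lfloor>q i\<rfloor>)"
    have "j i \<le> K" for i
      unfolding j_def K_def using q by (intro nat_mono floor_mono)
    then show "p j \<in> G"
      unfolding G_def by auto
    show "N (x - p j) \<le> hi * \<rho>"
    proof (rule le_hi)
      fix i
      have jq: "real (j i) \<le> q i" "q i \<le> real (j i) + 1"
        using q[of i] unfolding j_def by linarith+
      have "(x - p j) $ i = \<rho> * (q i - real (j i))"
        using assms by (simp add: p_def q_def field_simps)
      moreover have "\<bar>q i - real (j i)\<bar> \<le> 1"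
        using jq by linarith
      ultimately show "\<bar>(x - p j) $ i\<bar> \<le> \<rho>"
        using assms by (simp add: abs_mult)
    qed
  qed
  have "G \<noteq> {}"
    unfolding G_def by (simp add: PiE_eq_empty_iff)
  moreover have "finite G"
    unfolding G_def using fin by simp
  ultimately show ?thesis
    using card near by (intro that)
qed

text \<open>
  Points of \<open>\<beta>\<close> outside the cube \<open>Q\<close> must not be counted. Adding to \<open>\<beta> \<inter> Q\<close> a grid that comes within
  \<open>t\<close> of every point of \<open>Q\<close> makes them harmless: seen from the slightly smaller cube \<open>Q'\<close> they are
  at distance at least \<open>t\<close>, so there the distance to the enlarged set is at most the distance to \<open>\<beta>\<close>.
  The same grid also pays for the truncation of the distance at \<open>t\<close>, and the truncation is what later
  allows the weight function to be changed by an \<open>L\<^sup>1\<close>-small amount. The bound then follows by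
  rescaling \<open>Q'\<close> to the unit cube.
\<close>
lemma cube_lower_bound:
  fixes a :: "real ^ 'n" and s t h :: real
  assumes "0 < s" and \<beta>: "finite \<beta>" "\<beta> \<noteq> {}" and t: "0 < t" "2 * t / lo < h"
  defines "Q \<equiv> cbox a (a + h *\<^sub>R 1)"
  shows "quant_const N s * ennreal ((h - 2 * t / lo) powr (s + CARD('n)) *
        (real (card (\<beta> \<inter> Q)) + (hi * h / t + 1) ^ CARD('n)) powr (- (s / CARD('n))))
      \<le> (\<integral>\<^sup>+x. ennreal (min (set_dist N x \<beta>) t powr s) * indicator Q x \<partial>lborel)"
proof -
  define l where "l = h - 2 * t / lo"
  define a' where "a' = a + (t / lo) *\<^sub>R (1 :: real ^ 'n)"
  define Q' where "Q' = cbox a' (a' + l *\<^sub>R 1)"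
  have h: "0 < h" and l: "0 < l"
    using t lo_pos unfolding l_def by (auto intro: less_trans[rotated])
  obtain G where G: "finite G" "G \<noteq> {}" "real (card G) \<le> (h / (t / hi) + 1) ^ CARD('n)"
    and near: "\<And>x. x \<in> Q \<Longrightarrow> \<exists>g\<in>G. N (x - g) \<le> hi * (t / hi)"
    using cube_grid[of "t / hi" h a] h t hi_pos unfolding Q_def by auto
  define \<gamma> where "\<gamma> = (\<beta> \<inter> Q) \<union> G"
  have \<gamma>: "finite \<gamma>" "\<gamma> \<noteq> {}"
    using \<beta> G by (auto simp: \<gamma>_def)
  have Q'_iff: "x \<in> Q' \<longleftrightarrow> (\<forall>i. a $ i + t / lo \<le> x $ i \<and> x $ i \<le> a $ i + h - t / lo)" for x
    unfolding Q'_def cube_iff by (simp add: a'_def l_def algebra_simps)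
  have QQ: "x \<in> Q" if "x \<in> Q'" for x
    unfolding Q_def cube_iff
  proof
    fix i
    have "a $ i + t / lo \<le> x $ i \<and> x $ i \<le> a $ i + h - t / lo" "0 < t / lo"
      using that t lo_pos by (auto simp: Q'_iff)
    then show "a $ i \<le> x $ i \<and> x $ i \<le> a $ i + h" by linarith
  qed
  have le_min: "set_dist N x \<gamma> \<le> min (set_dist N x \<beta>) t" if x: "x \<in> Q'" for x
  proof -
    obtain g where g: "g \<in> G" "N (x - g) \<le> t"
      using near[OF QQ[OF x]] hi_pos by auto
    then have le_t: "set_dist N x \<gamma> \<le> t"
      using set_dist_le[OF \<gamma>(1), of g x] by (auto simp: \<gamma>_def)
    obtain b where b: "b \<in> \<beta>" "set_dist N x \<beta> = N (x - b)"
      using set_dist_attained \<beta> by metis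
    have "set_dist N x \<gamma> \<le> N (x - b)"
    proof (cases "b \<in> Q")
      case True
      then show ?thesis using b set_dist_le[OF \<gamma>(1), of b x] by (auto simp: \<gamma>_def)
    next
      case False
      then obtain i where i: "\<not> (a $ i \<le> b $ i \<and> b $ i \<le> a $ i + h)"
        unfolding Q_def cube_iff by auto
      have "a $ i + t / lo \<le> x $ i \<and> x $ i \<le> a $ i + h - t / lo"
        using x by (simp add: Q'_iff)
      with i have "t / lo \<le> \<bar>(x - b) $ i\<bar>"
        by auto
      then have "t \<le> lo * \<bar>(x - b) $ i\<bar>"
        using lo_pos by (simp add: field_simps)
      with lo_le[of "x - b" i] le_t show ?thesis by linarith
    qed
    with b le_t show ?thesis by simp
  qed
  define \<gamma>' where "\<gamma>' = (\<lambda>x. (x - a') /\<^sub>R l) ` \<gamma>"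
  have \<gamma>': "finite \<gamma>'" "\<gamma>' \<noteq> {}" "card \<gamma>' \<le> card \<gamma>"
    using \<gamma> by (auto simp: \<gamma>'_def card_image_le)
  have \<gamma>_eq: "\<gamma> = (\<lambda>y. a' + l *\<^sub>R y) ` \<gamma>'"
    unfolding \<gamma>'_def image_image using l by simp
  have Q'_affine: "a' + l *\<^sub>R x \<in> Q' \<longleftrightarrow> x \<in> cbox 0 1" for x
    unfolding Q'_def cube_iff using l by (simp add: mem_box_cart zero_le_mult_iff)
  define m where "m = real (card \<gamma>)"
  have m: "1 \<le> m" "m \<le> real (card (\<beta> \<inter> Q)) + (hi * h / t + 1) ^ CARD('n)"
  proof -
    show "1 \<le> m" using \<gamma> by (simp add: m_def Suc_le_eq card_gt_0_iff)
    have "m \<le> real (card (\<beta> \<inter> Q)) + real (card G)"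
      unfolding m_def \<gamma>_def using card_Un_le[of "\<beta> \<inter> Q" G] by linarith
    with G show "m \<le> real (card (\<beta> \<inter> Q)) + (hi * h / t + 1) ^ CARD('n)"
      by (simp add: mult.commute)
  qed
  have "quant_const N s * ennreal (l powr (s + CARD('n)) *
        (real (card (\<beta> \<inter> Q)) + (hi * h / t + 1) ^ CARD('n)) powr (- (s / CARD('n))))
    \<le> quant_const N s * ennreal (l powr (s + CARD('n)) * m powr (- (s / CARD('n))))"
    using m assms by (intro mult_left_mono ennreal_leI powr_mono2') auto
  also have "\<dots> \<le> (ennreal (m powr (s / CARD('n))) * distortion N s unit_cube_measure \<gamma>')
      * ennreal (l powr (s + CARD('n)) * m powr (- (s / CARD('n))))"
    unfolding m_def using \<gamma> \<gamma>' assms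
    by (intro mult_right_mono quant_const_le) (auto simp: quantizer_def Suc_le_eq card_gt_0_iff)
  also have "\<dots> = ennreal (m powr (s / CARD('n)) * (l powr (s + CARD('n)) * m powr (- (s / CARD('n)))))
      * distortion N s unit_cube_measure \<gamma>'"
    by (simp add: ennreal_mult mult_ac)
  also have "m powr (s / CARD('n)) * (l powr (s + CARD('n)) * m powr (- (s / CARD('n)))) = l ^ CARD('n) * l powr s"
    using m l by (simp add: powr_add powr_minus powr_realpow field_simps)
  also have "ennreal (l ^ CARD('n) * l powr s) * distortion N s unit_cube_measure \<gamma>'
      = ennreal (l ^ CARD('n)) * (\<integral>\<^sup>+x. ennreal (l powr s) *
          (ennreal (set_dist N x \<gamma>' powr s) * indicator (cbox 0 1) x) \<partial>lborel)"
    unfolding distortion_def using \<gamma>' l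
    by (subst nn_integral_unit_cube_measure, measurable, subst nn_integral_cmult)
       (simp_all add: ennreal_mult mult.assoc)
  also have "(\<lambda>x. ennreal (l powr s) * (ennreal (set_dist N x \<gamma>' powr s) * indicator (cbox 0 1) x))
      = (\<lambda>x. ennreal (set_dist N (a' + l *\<^sub>R x) \<gamma> powr s) * indicator Q' (a' + l *\<^sub>R x))"
    unfolding \<gamma>_eq using \<gamma>' l set_dist_nonneg[of \<gamma>']
    by (auto simp: fun_eq_iff set_dist_affine powr_mult ennreal_mult Q'_affine indicator_def)
  also have "ennreal (l ^ CARD('n)) * (\<integral>\<^sup>+x. ennreal (set_dist N (a' + l *\<^sub>R x) \<gamma> powr s) *
      indicator Q' (a' + l *\<^sub>R x) \<partial>lborel) = (\<integral>\<^sup>+x. ennreal (set_dist N x \<gamma> powr s) * indicator Q' x \<partial>lborel)"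
    using \<gamma> l by (subst nn_integral_lborel_affine[of _ l a', symmetric]) (auto simp: Q'_def)
  also have "\<dots> \<le> (\<integral>\<^sup>+x. ennreal (min (set_dist N x \<beta>) t powr s) * indicator Q x \<partial>lborel)"
  proof (rule nn_integral_mono)
    fix x :: "real ^ 'n"
    have "set_dist N x \<gamma> powr s \<le> min (set_dist N x \<beta>) t powr s" if "x \<in> Q'"
      using le_min[OF that] set_dist_nonneg[OF \<gamma>] assms by (intro powr_mono2) auto
    then show "ennreal (set_dist N x \<gamma> powr s) * indicator Q' x
        \<le> ennreal (min (set_dist N x \<beta>) t powr s) * indicator Q x"
      using QQ[of x] by (auto split: split_indicator)
  qed
  finally show ?thesis
    unfolding l_def .
qed

end

section \<open>Averaging over cubes\<close>

definition cube_average :: "real \<Rightarrow> (real ^ 'n \<Rightarrow> real) \<Rightarrow> real ^ 'n \<Rightarrow> real" where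
  "cube_average h g x =
     enn2real (\<integral>\<^sup>+y. ennreal (g y) * indicator (cbox x (x + h *\<^sub>R 1)) y \<partial>lborel) / h ^ CARD('n)"

lemma measurable_cube_kernel:
  "(\<lambda>z. indicator (cbox (fst z) (fst z + h *\<^sub>R (1 :: real ^ 'n))) (snd z) :: ennreal)
    \<in> borel_measurable (lborel \<Otimes>\<^sub>M lborel)"
proof -
  define K where "K = {z :: (real ^ 'n) \<times> (real ^ 'n). \<forall>i. fst z $ i \<le> snd z $ i \<and> snd z $ i \<le> fst z $ i + h}"
  have "closed K"
    unfolding K_def by (intro closed_Collect_all closed_Collect_conj closed_Collect_le continuous_intros)
  then have "K \<in> sets borel"
    by (rule borel_closed)
  moreover have "sets (lborel \<Otimes>\<^sub>M lborel) = sets (borel :: ((real ^ 'n) \<times> (real ^ 'n)) measure)"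
    by (metis borel_prod sets_lborel sets_pair_measure_cong)
  ultimately have K: "K \<in> sets (lborel \<Otimes>\<^sub>M lborel)"
    by simp
  have "(\<lambda>z. indicator (cbox (fst z) (fst z + h *\<^sub>R (1 :: real ^ 'n))) (snd z) :: ennreal) = indicator K"
    by (auto simp: fun_eq_iff indicator_def cube_iff K_def)
  then show ?thesis
    using K by simp
qed

lemma measurable_cube_average [measurable]:
  fixes g :: "real ^ 'n \<Rightarrow> real"
  assumes [measurable]: "g \<in> borel_measurable borel"
  shows "cube_average h g \<in> borel_measurable borel"
proof -
  note [measurable] = measurable_cube_kernel[of h]
  have "(\<lambda>z. ennreal (g (snd z)) * indicator (cbox (fst z) (fst z + h *\<^sub>R 1)) (snd z))
      \<in> borel_measurable (lborel \<Otimes>\<^sub>M lborel)"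
    by measurable
  then have "(\<lambda>x. \<integral>\<^sup>+y. ennreal (g y) * indicator (cbox x (x + h *\<^sub>R 1)) y \<partial>lborel) \<in> borel_measurable lborel"
    by (intro lborel.borel_measurable_nn_integral) (simp add: split_beta)
  then show ?thesis
    unfolding cube_average_def[abs_def] by simp
qed

lemma ennreal_cube_average:
  fixes g :: "real ^ 'n \<Rightarrow> real"
  assumes "integrable lborel g" "\<And>x. 0 \<le> g x" "0 < h"
  shows "ennreal (cube_average h g x) =
    ennreal (1 / h ^ CARD('n)) * (\<integral>\<^sup>+y. ennreal (g y) * indicator (cbox x (x + h *\<^sub>R 1)) y \<partial>lborel)"
proof -
  have "(\<integral>\<^sup>+y. ennreal (g y) * indicator (cbox x (x + h *\<^sub>R 1)) y \<partial>lborel) \<le> (\<integral>\<^sup>+y. ennreal (g y) \<partial>lborel)"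
    by (intro nn_integral_mono) (auto split: split_indicator)
  also have "\<dots> < \<infinity>"
    using assms by (simp add: nn_integral_eq_integral)
  finally show ?thesis
    unfolding cube_average_def using assms by (simp add: ennreal_mult' divide_inverse mult.commute)
qed

text \<open>
  Fubini: averaging \<open>g\<close> over the cube with lower corner \<open>x\<close> is dual to averaging \<open>\<psi>\<close> over the cube
  with upper corner \<open>y\<close>. In this way one bound for cubes, applied to all translates at once, replaces a
  decomposition of the space into cubes on which the weight is nearly constant.
\<close>
lemma nn_integral_cube_average:
  fixes g :: "real ^ 'n \<Rightarrow> real" and \<psi> :: "real ^ 'n \<Rightarrow> ennreal"
  assumes g: "integrable lborel g" "\<And>x. 0 \<le> g x" and h: "0 < h"
    and \<psi> [measurable]: "\<psi> \<in> borel_measurable borel"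
  shows "(\<integral>\<^sup>+x. ennreal (cube_average h g x) * \<psi> x \<partial>lborel) =
    (\<integral>\<^sup>+y. ennreal (g y) * (ennreal (1 / h ^ CARD('n)) *
        (\<integral>\<^sup>+x. \<psi> x * indicator (cbox (y - h *\<^sub>R 1) (y - h *\<^sub>R 1 + h *\<^sub>R 1)) x \<partial>lborel)) \<partial>lborel)"
proof -
  have [measurable]: "g \<in> borel_measurable borel"
    using g by auto
  note [measurable] = measurable_cube_kernel[of h]
  let ?k = "\<lambda>x y. indicator (cbox x (x + h *\<^sub>R (1 :: real ^ 'n))) y :: ennreal"
  let ?c = "ennreal (1 / h ^ CARD('n))"
  have m1: "(\<lambda>(x, y). ?c * (ennreal (g y) * ?k x y) * \<psi> x) \<in> borel_measurable (lborel \<Otimes>\<^sub>M lborel)"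
    unfolding split_beta by measurable
  have "(\<integral>\<^sup>+x. ennreal (cube_average h g x) * \<psi> x \<partial>lborel)
      = (\<integral>\<^sup>+x. \<integral>\<^sup>+y. ?c * (ennreal (g y) * ?k x y) * \<psi> x \<partial>lborel \<partial>lborel)"
    by (intro nn_integral_cong) (simp add: ennreal_cube_average g h nn_integral_cmult nn_integral_multc)
  also have "\<dots> = (\<integral>\<^sup>+y. \<integral>\<^sup>+x. ?c * (ennreal (g y) * ?k x y) * \<psi> x \<partial>lborel \<partial>lborel)"
    using lborel_pair.Fubini'[OF m1] by simp
  also have "\<dots> = (\<integral>\<^sup>+y. \<integral>\<^sup>+x. ennreal (g y) * (?c * (\<psi> x *
      indicator (cbox (y - h *\<^sub>R 1) (y - h *\<^sub>R 1 + h *\<^sub>R 1)) x)) \<partial>lborel \<partial>lborel)"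
  proof (intro nn_integral_cong)
    fix x y :: "real ^ 'n"
    have "y \<in> cbox x (x + h *\<^sub>R 1) \<longleftrightarrow> x \<in> cbox (y - h *\<^sub>R 1) (y - h *\<^sub>R 1 + h *\<^sub>R 1)"
      unfolding cube_iff by (auto simp: algebra_simps)
    then have "?k x y = indicator (cbox (y - h *\<^sub>R 1) (y - h *\<^sub>R 1 + h *\<^sub>R 1)) x"
      by (simp add: indicator_def)
    then show "?c * (ennreal (g y) * ?k x y) * \<psi> x =
      ennreal (g y) * (?c * (\<psi> x * indicator (cbox (y - h *\<^sub>R 1) (y - h *\<^sub>R 1 + h *\<^sub>R 1)) x))"
      by (simp add: mult_ac)
  qed
  also have "\<dots> = (\<integral>\<^sup>+y. ennreal (g y) * (?c *
      (\<integral>\<^sup>+x. \<psi> x * indicator (cbox (y - h *\<^sub>R 1) (y - h *\<^sub>R 1 + h *\<^sub>R 1)) x \<partial>lborel)) \<partial>lborel)"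
    by (intro nn_integral_cong) (simp add: nn_integral_cmult)
  finally show ?thesis .
qed

text \<open>
  The averages converge almost everywhere by Lebesgue differentiation and have the same mass as \<open>g\<close>,
  so they converge in \<open>L\<^sup>1\<close> by Scheffe's lemma.
\<close>
lemma cube_average_L1_tendsto:
  fixes g :: "real ^ 'n \<Rightarrow> real"
  assumes g: "integrable lborel g" "\<And>x. 0 \<le> g x"
  shows "(\<lambda>k. \<integral>\<^sup>+x. ennreal \<bar>cube_average (inverse (real (Suc k))) g x - g x\<bar> \<partial>lborel) \<longlonglongrightarrow> 0"
proof -
  have [measurable]: "g \<in> borel_measurable borel"
    using g by auto
  let ?h = "\<lambda>k. inverse (real (Suc k))"
  have avg_nonneg: "0 \<le> cube_average (?h k) g x" for k x
    unfolding cube_average_def by simp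
  have int: "integrable lborel (\<lambda>y. indicator (cbox a b) y *\<^sub>R g y)" for a b
    using g by (intro integrable_mult_indicator) auto
  have "g integrable_on cbox a b" for a b
    using set_borel_integral_eq_integral(1)[of "cbox a b" g] int unfolding set_integrable_def by simp
  then obtain Z where Z: "negligible Z" and lim: "\<And>x e. \<lbrakk>x \<notin> Z; 0 < e\<rbrakk> \<Longrightarrow>
      \<exists>d>0. \<forall>h. 0 < h \<and> h < d \<longrightarrow>
        norm (integral (cbox x (x + h *\<^sub>R \<Sum>Basis)) g /\<^sub>R h ^ DIM(real ^ 'n) - g x) < e"
    using integrable_ccontinuous_explicit[of g] by metis
  have avg_eq: "cube_average h g x = integral (cbox x (x + h *\<^sub>R 1)) g /\<^sub>R h ^ CARD('n)" if "0 < h" for h x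
  proof -
    have "(\<integral>\<^sup>+y. ennreal (g y) * indicator (cbox x (x + h *\<^sub>R 1)) y \<partial>lborel)
        = (\<integral>\<^sup>+y. ennreal (indicator (cbox x (x + h *\<^sub>R 1)) y *\<^sub>R g y) \<partial>lborel)"
      by (intro nn_integral_cong) (auto split: split_indicator)
    also have "\<dots> = ennreal (set_lebesgue_integral lborel (cbox x (x + h *\<^sub>R 1)) g)"
      unfolding set_lebesgue_integral_def using int g by (intro nn_integral_eq_integral) auto
    also have "set_lebesgue_integral lborel (cbox x (x + h *\<^sub>R 1)) g = integral (cbox x (x + h *\<^sub>R 1)) g"
      using int unfolding set_integrable_def[symmetric] by (rule set_borel_integral_eq_integral(2))
    finally show ?thesis
      unfolding cube_average_def using g by (simp add: divide_inverse integral_nonneg mult.commute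
        \<open>\<And>a b. g integrable_on cbox a b\<close>)
  qed
  have lim': "(\<lambda>k. cube_average (?h k) g x) \<longlonglongrightarrow> g x" if x: "x \<notin> Z" for x
  proof (rule LIMSEQ_I)
    fix e :: real assume "0 < e"
    then obtain d where d: "0 < d" "\<And>h. 0 < h \<Longrightarrow> h < d \<Longrightarrow>
        norm (integral (cbox x (x + h *\<^sub>R 1)) g /\<^sub>R h ^ CARD('n) - g x) < e"
      using lim[OF x \<open>0 < e\<close>] unfolding sum_Basis_eq_1 by auto
    obtain K where K: "?h K < d"
      using reals_Archimedean[OF d(1)] by auto
    have "norm (cube_average (?h k) g x - g x) < e" if "K \<le> k" for k
    proof -
      have "?h k \<le> ?h K" using that by (intro le_imp_inverse_le) auto
      then have "?h k < d" using K by linarith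
      then show ?thesis
        using d(2)[of "?h k"] by (subst avg_eq) auto
    qed
    then show "\<exists>K. \<forall>k\<ge>K. norm (cube_average (?h k) g x - g x) < e" by blast
  qed
  have AE: "AE x in lborel. (\<lambda>k. cube_average (?h k) g x) \<longlonglongrightarrow> g x"
  proof -
    have "AE x in lebesgue. x \<notin> Z"
      using Z by (simp add: negligible_iff_null_sets AE_not_in)
    then have "AE x in lebesgue. (\<lambda>k. cube_average (?h k) g x) \<longlonglongrightarrow> g x"
      by eventually_elim (rule lim')
    then show ?thesis
      by (subst (asm) AE_completion_iff) auto
  qed
  have mass: "(\<integral>\<^sup>+x. ennreal (cube_average (?h k) g x) \<partial>lborel) = (\<integral>\<^sup>+x. ennreal (g x) \<partial>lborel)" for k
  proof -
    have "(\<integral>\<^sup>+x. indicator (cbox (y - ?h k *\<^sub>R 1) (y - ?h k *\<^sub>R 1 + ?h k *\<^sub>R 1)) x \<partial>lborel)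
        = ennreal (?h k ^ CARD('n))" for y :: "real ^ 'n"
      using emeasure_cube[of "?h k" "y - ?h k *\<^sub>R 1"] by (subst nn_integral_indicator) auto
    moreover have "ennreal (1 / ?h k ^ CARD('n)) * ennreal (?h k ^ CARD('n)) = 1"
      by (subst ennreal_mult[symmetric]) auto
    ultimately show ?thesis
      using nn_integral_cube_average[OF g, of "?h k" "\<lambda>_. 1"] by simp
  qed
  show ?thesis
    using Scheffe_lemma2[of "\<lambda>k. cube_average (?h k) g" lborel g] g AE mass avg_nonneg
    by (simp del: of_nat_Suc)
qed

text \<open>
  The density of the normalized counting measure of \<open>\<beta>\<close>, smoothed at scale \<open>h\<close>. The cube has upper
  corner \<open>y\<close>, as required by the duality with \<open>cube_average\<close>; its upper bound is not simplified to \<open>y\<close>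
  so that the facts on cubes with a given lower corner apply syntactically.
\<close>
definition local_density :: "(real ^ 'n) set \<Rightarrow> nat \<Rightarrow> real \<Rightarrow> real ^ 'n \<Rightarrow> real" where
  "local_density \<beta> n h y =
     real (card (\<beta> \<inter> cbox (y - h *\<^sub>R 1) (y - h *\<^sub>R 1 + h *\<^sub>R 1))) / (real n * h ^ CARD('n))"

lemma local_density_nonneg: "0 \<le> h \<Longrightarrow> 0 \<le> local_density \<beta> n h y"
  unfolding local_density_def by simp

lemma card_Int_cube:
  fixes \<beta> :: "(real ^ 'n) set"
  assumes "finite \<beta>"
  shows "real (card (\<beta> \<inter> cbox (y - h *\<^sub>R 1) (y - h *\<^sub>R 1 + h *\<^sub>R 1)))
    = (\<Sum>b\<in>\<beta>. indicator (cbox b (b + h *\<^sub>R 1)) y)"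
proof -
  have "b \<in> cbox (y - h *\<^sub>R 1) (y - h *\<^sub>R 1 + h *\<^sub>R 1) \<longleftrightarrow> y \<in> cbox b (b + h *\<^sub>R 1)" for b
    unfolding cube_iff by (auto simp: algebra_simps)
  then have "(\<Sum>b\<in>\<beta>. indicator (cbox b (b + h *\<^sub>R 1)) y)
      = (\<Sum>b\<in>\<beta>. indicator (cbox (y - h *\<^sub>R 1) (y - h *\<^sub>R 1 + h *\<^sub>R 1)) b :: real)"
    by (simp add: indicator_def)
  then show ?thesis
    using assms by (simp add: indicator_def sum.If_cases Int_def)
qed

lemma measurable_local_density:
  fixes \<beta> :: "(real ^ 'n) set"
  assumes "finite \<beta>"
  shows "local_density \<beta> n h \<in> borel_measurable borel"
  unfolding local_density_def[abs_def] card_Int_cube[OF assms] by measurable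

text \<open>
  Each point of \<open>\<beta>\<close> lies in the cube of \<open>y\<close> for a set of \<open>y\<close> of measure \<open>h ^ d\<close>.
\<close>
lemma local_density_mass:
  fixes \<beta> :: "(real ^ 'n) set"
  assumes "finite \<beta>" "card \<beta> \<le> n" "1 \<le> n" "0 < h"
  shows "(\<integral>\<^sup>+y. ennreal (local_density \<beta> n h y) \<partial>lborel) \<le> 1"
proof -
  let ?c = "1 / (real n * h ^ CARD('n))"
  have "(\<integral>\<^sup>+y. ennreal (local_density \<beta> n h y) \<partial>lborel)
      = (\<integral>\<^sup>+y. ennreal ?c * (\<Sum>b\<in>\<beta>. indicator (cbox b (b + h *\<^sub>R 1)) y) \<partial>lborel)"
  proof (rule nn_integral_cong)
    fix y :: "real ^ 'n"
    have "ennreal (local_density \<beta> n h y) = ennreal (?c * (\<Sum>b\<in>\<beta>. indicator (cbox b (b + h *\<^sub>R 1)) y))"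
      unfolding local_density_def card_Int_cube[OF assms(1)] by simp
    also have "\<dots> = ennreal ?c * (\<Sum>b\<in>\<beta>. ennreal (indicator (cbox b (b + h *\<^sub>R 1)) y))"
      using assms by (subst ennreal_mult) (auto simp: sum_nonneg sum_ennreal)
    finally show "ennreal (local_density \<beta> n h y) = ennreal ?c * (\<Sum>b\<in>\<beta>. indicator (cbox b (b + h *\<^sub>R 1)) y)"
      by (simp add: ennreal_indicator)
  qed
  also have "\<dots> = ennreal ?c * (\<Sum>b\<in>\<beta>. ennreal (h ^ CARD('n)))"
    using assms by (simp add: nn_integral_cmult nn_integral_sum emeasure_cube)
  also have "\<dots> = ennreal (real (card \<beta>) / real n)"
    using assms by (simp add: ennreal_of_nat_eq_real_of_nat flip: ennreal_mult)
  also have "\<dots> \<le> 1"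
    using assms by (simp add: divide_le_eq)
  finally show ?thesis .
qed

context comparable_norm
begin

text \<open>
  The cube bound with \<open>t = \<tau> n powr (- 1 / d)\<close>, multiplied by \<open>g y\<close> and integrated over the position
  \<open>y\<close> of the cube. At this scale the grid has at most \<open>n h ^ d ((hi + \<kappa>) / \<tau>) ^ d\<close> points, so it adds a
  constant to the local density which vanishes as \<open>\<tau>\<close> grows, and the rescaled truncated distance is
  bounded by \<open>\<tau> powr s\<close>, so replacing the average of \<open>g\<close> by \<open>g\<close> costs a multiple of the \<open>L\<^sup>1\<close> error.
  The inequality holds for each \<open>n\<close>; \<open>\<kappa>\<close> is the ratio of \<open>t\<close> to \<open>h\<close> and tends to zero as \<open>n\<close> grows.
\<close>
lemma averaged_lower_bound:
  fixes g :: "real ^ 'n \<Rightarrow> real" and s h \<tau> \<kappa> :: real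
  assumes s: "0 < s" and n: "1 \<le> n" and \<beta>: "finite \<beta>" "\<beta> \<noteq> {}"
    and g: "integrable lborel g" "\<And>x. 0 \<le> g x"
    and h: "0 < h" and \<tau>: "0 < \<tau>"
    and \<kappa>_def: "\<kappa> = \<tau> * real n powr (- (1 / CARD('n))) / h" and \<kappa>: "2 * \<kappa> < lo"
  shows "quant_const N s * (\<integral>\<^sup>+y. ennreal ((1 - 2 * \<kappa> / lo) powr (s + CARD('n)) *
        (g y * (local_density \<beta> n h y + ((hi + \<kappa>) / \<tau>) ^ CARD('n)) powr (- (s / CARD('n))))) \<partial>lborel)
    \<le> ennreal (real n powr (s / CARD('n))) * (\<integral>\<^sup>+x. ennreal (g x * set_dist N x \<beta> powr s) \<partial>lborel)
      + ennreal (\<tau> powr s) * (\<integral>\<^sup>+x. ennreal \<bar>cube_average h g x - g x\<bar> \<partial>lborel)"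
proof -
  define d where "d = CARD('n)"
  have d: "0 < d" by (simp add: d_def)
  have [measurable]: "g \<in> borel_measurable borel"
    using g by auto
  note [measurable] = measurable_local_density[OF \<beta>(1)]
  let ?Q = "\<lambda>y. cbox (y - h *\<^sub>R 1) (y - h *\<^sub>R (1 :: real ^ 'n) + h *\<^sub>R 1)"
  define t where "t = \<tau> * real n powr (- (1 / d))"
  define c where "c = (1 - 2 * \<kappa> / lo) powr (s + d)"
  define \<psi> where "\<psi> = (\<lambda>x. min (set_dist N x \<beta>) t powr s)"
  define v where "v = (\<lambda>y. local_density \<beta> n h y + ((hi + \<kappa>) / \<tau>) ^ d)"
  have t: "0 < t" "t = \<kappa> * h"
    using \<tau> n h by (auto simp: t_def \<kappa>_def d_def)
  have \<kappa>_pos: "0 < \<kappa>"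
    using \<tau> n h by (simp add: \<kappa>_def)
  have \<kappa>_pow: "\<kappa> ^ d * (real n * h ^ d) = \<tau> ^ d"
  proof -
    have "(real n powr (- (1 / d))) ^ d = real n powr (- (1 / d) * d)"
      using n by (subst powr_realpow[symmetric], simp, subst powr_powr) simp
    also have "\<dots> = 1 / real n"
      using d n by (simp add: powr_minus_divide)
    finally show ?thesis
      using h n unfolding \<kappa>_def d_def[symmetric] by (simp add: power_mult_distrib power_divide)
  qed
  have \<psi>_meas [measurable]: "\<psi> \<in> borel_measurable borel"
    unfolding \<psi>_def using \<beta> by measurable
  have \<psi>_le: "real n powr (s / d) * \<psi> x \<le> \<tau> powr s" "\<psi> x \<le> set_dist N x \<beta> powr s" "0 \<le> \<psi> x" for x
  proof -
    have "\<psi> x \<le> t powr s"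
      unfolding \<psi>_def using s t set_dist_nonneg[OF \<beta>] by (intro powr_mono2) auto
    then have "real n powr (s / d) * \<psi> x \<le> real n powr (s / d) * t powr s"
      by (intro mult_left_mono) auto
    also have "\<dots> = \<tau> powr s"
      unfolding t_def using n \<tau>
      by (subst powr_mult, simp, simp, subst powr_powr) (simp add: powr_minus field_simps)
    finally show "real n powr (s / d) * \<psi> x \<le> \<tau> powr s" .
    show "\<psi> x \<le> set_dist N x \<beta> powr s"
      unfolding \<psi>_def using s t set_dist_nonneg[OF \<beta>] by (intro powr_mono2) auto
  qed (simp add: \<psi>_def)
  have cube: "quant_const N s * ennreal (c * v y powr (- (s / d)))
      \<le> ennreal (real n powr (s / d)) * (ennreal (1 / h ^ d) *
          (\<integral>\<^sup>+x. ennreal (\<psi> x) * indicator (?Q y) x \<partial>lborel))" for y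
  proof -
    have "2 * t / lo < h"
      using t \<kappa> h lo_pos by (simp add: field_simps)
    then have "quant_const N s * ennreal ((h - 2 * t / lo) powr (s + d) *
        (real (card (\<beta> \<inter> ?Q y)) + (hi * h / t + 1) ^ d) powr (- (s / d)))
      \<le> (\<integral>\<^sup>+x. ennreal (\<psi> x) * indicator (?Q y) x \<partial>lborel)"
      unfolding \<psi>_def d_def by (intro cube_lower_bound s \<beta> t)
    moreover have "(hi * h / t + 1) ^ d = ((hi + \<kappa>) / \<kappa>) ^ d"
      using t h \<kappa>_pos by (simp add: field_simps)
    moreover have "((hi + \<kappa>) / \<kappa>) ^ d = real n * h ^ d * ((hi + \<kappa>) / \<tau>) ^ d"
      unfolding power_divide \<kappa>_pow[symmetric] using \<kappa>_pos h n by simp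
    moreover have "real (card (\<beta> \<inter> ?Q y)) = real n * h ^ d * local_density \<beta> n h y"
      unfolding local_density_def using h n by (simp add: d_def)
    moreover have "h - 2 * t / lo = h * (1 - 2 * \<kappa> / lo)"
      using t by (simp add: algebra_simps)
    ultimately have "quant_const N s * ennreal ((h * (1 - 2 * \<kappa> / lo)) powr (s + d) *
        (real n * h ^ d * v y) powr (- (s / d)))
      \<le> (\<integral>\<^sup>+x. ennreal (\<psi> x) * indicator (?Q y) x \<partial>lborel)"
      by (simp add: v_def distrib_left)
    moreover have "(h * (1 - 2 * \<kappa> / lo)) powr (s + d) * (real n * h ^ d * v y) powr (- (s / d))
      = h ^ d * real n powr (- (s / d)) * (c * v y powr (- (s / d)))"
    proof -
      have "v y \<ge> 0"
        unfolding v_def using local_density_nonneg[of h] h \<kappa>_pos hi_pos \<tau>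
        by (intro add_nonneg_nonneg) auto
      moreover have "0 \<le> 1 - 2 * \<kappa> / lo"
        using \<kappa> lo_pos by (simp add: field_simps)
      moreover have "(h ^ d) powr (- (s / d)) = h powr (- s)"
        using h d by (subst powr_realpow[symmetric]) (auto simp: powr_powr)
      moreover have "h powr (s + d) = h powr s * h ^ d"
        using h by (simp add: powr_add powr_realpow)
      moreover have "h powr s * h powr (- s) = 1"
        using h by (simp flip: powr_add)
      ultimately show ?thesis
        using h n by (simp add: powr_mult c_def)
    qed
    ultimately have "quant_const N s * ennreal (h ^ d * real n powr (- (s / d)) * (c * v y powr (- (s / d))))
      \<le> (\<integral>\<^sup>+x. ennreal (\<psi> x) * indicator (?Q y) x \<partial>lborel)"
      by simp
    then have "ennreal (real n powr (s / d) * (1 / h ^ d)) *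
       (quant_const N s * ennreal (h ^ d * real n powr (- (s / d)) * (c * v y powr (- (s / d)))))
      \<le> ennreal (real n powr (s / d) * (1 / h ^ d)) * (\<integral>\<^sup>+x. ennreal (\<psi> x) * indicator (?Q y) x \<partial>lborel)"
      by (rule mult_left_mono) simp
    moreover have "ennreal (real n powr (s / d) * (1 / h ^ d)) *
       (quant_const N s * ennreal (h ^ d * real n powr (- (s / d)) * (c * v y powr (- (s / d)))))
      = quant_const N s * ennreal (c * v y powr (- (s / d)))"
    proof -
      have "ennreal (real n powr (s / d) * (1 / h ^ d)) * ennreal (h ^ d * real n powr (- (s / d)) * (c * v y powr (- (s / d))))
        = ennreal (real n powr (s / d) * (1 / h ^ d) * (h ^ d * real n powr (- (s / d)) * (c * v y powr (- (s / d)))))"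
        using h by (intro ennreal_mult[symmetric]) (auto simp: c_def)
      also have "real n powr (s / d) * (1 / h ^ d) * (h ^ d * real n powr (- (s / d)) * (c * v y powr (- (s / d))))
        = c * v y powr (- (s / d))"
        using n h by (simp add: powr_minus)
      finally show ?thesis
        by (simp add: mult_ac)
    qed
    moreover have "ennreal (real n powr (s / d) * (1 / h ^ d)) = ennreal (real n powr (s / d)) * ennreal (1 / h ^ d)"
      using h by (intro ennreal_mult) auto
    ultimately show ?thesis
      by (simp add: mult.assoc)
  qed
  have [measurable]: "v \<in> borel_measurable borel"
    unfolding v_def by measurable
  have kernel: "(\<lambda>y. \<integral>\<^sup>+x. ennreal (\<psi> x) * indicator (?Q y) x \<partial>lborel) \<in> borel_measurable borel"
  proof -
    note [measurable] = measurable_pair_swap[OF measurable_cube_kernel[of h]]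
    have "(\<lambda>(y, x). ennreal (\<psi> x) * indicator (cbox x (x + h *\<^sub>R 1)) y) \<in> borel_measurable (lborel \<Otimes>\<^sub>M lborel)"
    proof -
      have "(\<lambda>(y, x). ennreal (\<psi> x) * indicator (cbox x (x + h *\<^sub>R 1)) y)
        = (\<lambda>z. ennreal (\<psi> (snd z)) * (case z of (x, y) \<Rightarrow>
            indicator (cbox (fst (y, x)) (fst (y, x) + h *\<^sub>R 1)) (snd (y, x))))"
        by (auto simp: fun_eq_iff)
      also have "\<dots> \<in> borel_measurable (lborel \<Otimes>\<^sub>M lborel)"
        by measurable
      finally show ?thesis .
    qed
    then have "(\<lambda>y. \<integral>\<^sup>+x. ennreal (\<psi> x) * indicator (cbox x (x + h *\<^sub>R 1)) y \<partial>lborel) \<in> borel_measurable lborel"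
      by (rule lborel.borel_measurable_nn_integral)
    moreover have "y \<in> cbox x (x + h *\<^sub>R 1) \<longleftrightarrow> x \<in> ?Q y" for x y
      unfolding cube_iff by (auto simp: algebra_simps)
    ultimately show ?thesis
      by (simp add: indicator_def)
  qed
  have "quant_const N s * (\<integral>\<^sup>+y. ennreal (c * (g y * v y powr (- (s / d)))) \<partial>lborel)
      = (\<integral>\<^sup>+y. ennreal (g y) * (quant_const N s * ennreal (c * v y powr (- (s / d)))) \<partial>lborel)"
  proof (subst nn_integral_cmult[symmetric])
    show "(\<integral>\<^sup>+y. quant_const N s * ennreal (c * (g y * v y powr (- (s / d)))) \<partial>lborel)
      = (\<integral>\<^sup>+y. ennreal (g y) * (quant_const N s * ennreal (c * v y powr (- (s / d)))) \<partial>lborel)"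
      using g by (intro nn_integral_cong) (simp add: ennreal_mult c_def mult_ac)
  qed simp
  also have "\<dots> \<le> (\<integral>\<^sup>+y. ennreal (g y) * (ennreal (real n powr (s / d)) * (ennreal (1 / h ^ d) *
          (\<integral>\<^sup>+x. ennreal (\<psi> x) * indicator (?Q y) x \<partial>lborel))) \<partial>lborel)"
    by (intro nn_integral_mono mult_left_mono cube) simp
  also have "\<dots> = ennreal (real n powr (s / d)) * (\<integral>\<^sup>+y. ennreal (g y) * (ennreal (1 / h ^ d) *
          (\<integral>\<^sup>+x. ennreal (\<psi> x) * indicator (?Q y) x \<partial>lborel)) \<partial>lborel)"
    using kernel by (subst nn_integral_cmult[symmetric]) (auto simp: mult_ac intro!: nn_integral_cong)
  also have "\<dots> = ennreal (real n powr (s / d)) * (\<integral>\<^sup>+x. ennreal (cube_average h g x) * ennreal (\<psi> x) \<partial>lborel)"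
    unfolding d_def by (subst nn_integral_cube_average) (use g h in auto)
  also have "\<dots> \<le> (\<integral>\<^sup>+x. ennreal (real n powr (s / d)) * ennreal (g x * set_dist N x \<beta> powr s)
      + ennreal (\<tau> powr s) * ennreal \<bar>cube_average h g x - g x\<bar> \<partial>lborel)"
  proof (subst nn_integral_cmult[symmetric])
    show "(\<integral>\<^sup>+x. ennreal (real n powr (s / d)) * (ennreal (cube_average h g x) * ennreal (\<psi> x)) \<partial>lborel)
      \<le> (\<integral>\<^sup>+x. ennreal (real n powr (s / d)) * ennreal (g x * set_dist N x \<beta> powr s)
      + ennreal (\<tau> powr s) * ennreal \<bar>cube_average h g x - g x\<bar> \<partial>lborel)"
    proof (rule nn_integral_mono)
      fix x
      let ?A = "cube_average h g x"
      have A: "0 \<le> ?A"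
        unfolding cube_average_def using h by simp
      have "real n powr (s / d) * (?A * \<psi> x)
          \<le> real n powr (s / d) * (g x * \<psi> x) + \<bar>?A - g x\<bar> * (real n powr (s / d) * \<psi> x)"
      proof -
        have "0 \<le> real n powr (s / d) * \<psi> x" using \<psi>_le by simp
        then have "?A * (real n powr (s / d) * \<psi> x) \<le> (g x + \<bar>?A - g x\<bar>) * (real n powr (s / d) * \<psi> x)"
          by (intro mult_right_mono) auto
        then show ?thesis by (simp add: algebra_simps)
      qed
      also have "\<dots> \<le> real n powr (s / d) * (g x * set_dist N x \<beta> powr s) + \<bar>?A - g x\<bar> * \<tau> powr s"
        using \<psi>_le[of x] g by (intro add_mono mult_left_mono) auto
      finally show "ennreal (real n powr (s / d)) * (ennreal ?A * ennreal (\<psi> x))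
          \<le> ennreal (real n powr (s / d)) * ennreal (g x * set_dist N x \<beta> powr s)
            + ennreal (\<tau> powr s) * ennreal \<bar>?A - g x\<bar>"
        using A g \<psi>_le[of x] by (simp add: mult.commute flip: ennreal_mult ennreal_plus)
    qed
  qed (use g in measurable)
  also have "\<dots> = ennreal (real n powr (s / d)) * (\<integral>\<^sup>+x. ennreal (g x * set_dist N x \<beta> powr s) \<partial>lborel)
      + ennreal (\<tau> powr s) * (\<integral>\<^sup>+x. ennreal \<bar>cube_average h g x - g x\<bar> \<partial>lborel)"
    using \<beta> by (simp add: nn_integral_add nn_integral_cmult)
  finally show ?thesis
    unfolding c_def v_def d_def .
qed

end

section \<open>Stability of the optimal point density\<close>

text \<open>
  A quantitative form of the weighted inequality between arithmetic and geometric means, whose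
  equality case is \<open>v = w\<close>. After division by \<open>w\<close> and with \<open>z = v / w\<close> it reads
  \<open>z powr (- q) + q z \<ge> 1 + q + q (sqrt z - 1)\<^sup>2\<close> and follows from \<open>z powr (- q) \<ge> 1 - q ln z\<close> and
  \<open>ln z = 2 ln (sqrt z) \<le> 2 (sqrt z - 1)\<close>.
\<close>
lemma power_mean_tangent_bound:
  fixes w v q :: real
  assumes "0 < w" "0 < v" "0 < q"
  shows "(1 + q) * w + q * (sqrt v - sqrt w)\<^sup>2 \<le> w powr (1 + q) * v powr (- q) + q * v"
proof -
  have eq: "w powr (1 + q) * v powr (- q) = w * exp (- q * (ln v - ln w))"
    using assms by (simp add: powr_def exp_diff exp_add algebra_simps exp_minus field_simps)
  have "ln v - ln w = 2 * ln (sqrt v / sqrt w)"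
    using assms by (simp add: ln_div ln_sqrt)
  also have "\<dots> \<le> 2 * (sqrt v / sqrt w - 1)"
    using ln_le_minus_one[of "sqrt v / sqrt w"] assms by simp
  finally have "w * (ln v - ln w) \<le> w * (2 * (sqrt v / sqrt w - 1))"
    using assms by (intro mult_left_mono) auto
  also have "w * (2 * (sqrt v / sqrt w - 1)) = 2 * (sqrt v * sqrt w) - 2 * w"
  proof -
    have "w / sqrt w = sqrt w" using assms by (simp add: real_div_sqrt)
    then have "w * (sqrt v / sqrt w) = sqrt v * sqrt w" by (metis mult.commute times_divide_eq_right)
    moreover have "w * (2 * (sqrt v / sqrt w - 1)) = 2 * (w * (sqrt v / sqrt w)) - 2 * w"
      by (simp add: algebra_simps)
    ultimately show ?thesis by simp
  qed
  finally have "q * (w * (ln v - ln w)) \<le> q * (2 * (sqrt v * sqrt w) - 2 * w)"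
    using assms by (intro mult_left_mono) auto
  moreover have "w * (1 - q * (ln v - ln w)) \<le> w * exp (- q * (ln v - ln w))"
    using exp_ge_add_one_self[of "- q * (ln v - ln w)"] assms by (intro mult_left_mono) auto
  moreover have sq: "(sqrt v - sqrt w)\<^sup>2 = v - 2 * (sqrt v * sqrt w) + w"
    using assms by (simp add: power2_diff)
  ultimately show ?thesis
    unfolding eq sq by (simp add: algebra_simps)
qed

text \<open>
  Among densities \<open>u\<close> of mass at most 1 the energy \<open>\<integral> w powr (1 + q) * u powr (- q)\<close> is minimal, with
  value 1, exactly at \<open>u = w\<close>. Integrating the previous inequality shows that sequences approaching the
  minimum converge to \<open>w\<close>: the excess of the energy dominates the integral of
  \<open>q (sqrt (u + \<epsilon>) - sqrt w)\<^sup>2\<close>. The constant \<open>\<epsilon> j\<close> need not be integrable, so its contribution is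
  cut off at a multiple of \<open>w\<close> and then vanishes by dominated convergence.
\<close>
lemma stability_of_optimal_density:
  fixes w :: "'a \<Rightarrow> real" and u :: "nat \<Rightarrow> 'a \<Rightarrow> real" and \<epsilon> :: "nat \<Rightarrow> real" and b :: "nat \<Rightarrow> ennreal"
  assumes w [measurable]: "w \<in> borel_measurable M" and w_nonneg: "\<And>x. 0 \<le> w x"
    and w_mass: "(\<integral>\<^sup>+x. ennreal (w x) \<partial>M) = 1"
    and u [measurable]: "\<And>j. u j \<in> borel_measurable M" and u_nonneg: "\<And>j x. 0 \<le> u j x"
    and u_mass: "\<And>j. (\<integral>\<^sup>+x. ennreal (u j x) \<partial>M) \<le> 1"
    and \<epsilon>: "\<And>j. 0 < \<epsilon> j" "\<epsilon> \<longlonglongrightarrow> 0" and q: "0 < q"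
    and energy: "\<And>j. (\<integral>\<^sup>+x. ennreal (w x powr (1 + q) * (u j x + \<epsilon> j) powr (- q)) \<partial>M) \<le> b j"
    and b: "b \<longlonglongrightarrow> 1"
  obtains k where "strict_mono k" "AE x in M. 0 < w x \<longrightarrow> (\<lambda>j. u (k j) x + \<epsilon> (k j)) \<longlonglongrightarrow> w x"
proof -
  define A where "A = (\<lambda>j x. w x powr (1 + q) * (u j x + \<epsilon> j) powr (- q))"
  define m where "m = (\<lambda>j x. min (q * \<epsilon> j) ((1 + q) * w x))"
  define H where "H = (\<lambda>j x. A j x + q * u j x + m j x - (1 + q) * w x)"
  have [measurable]: "A j \<in> borel_measurable M" "m j \<in> borel_measurable M" "H j \<in> borel_measurable M" for j
    unfolding A_def m_def H_def by measurable
  have A_nonneg: "0 \<le> A j x" and m_nonneg: "0 \<le> m j x" for j x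
    using q \<epsilon>(1)[of j] w_nonneg[of x] by (auto simp: A_def m_def)
  have H_ge: "q * (sqrt (u j x + \<epsilon> j) - sqrt (w x))\<^sup>2 \<le> H j x" if "0 < w x" "q * \<epsilon> j \<le> (1 + q) * w x" for j x
    using power_mean_tangent_bound[OF that(1) _ q, of "u j x + \<epsilon> j"] that(2) u_nonneg[of j x] \<epsilon>(1)[of j]
    by (simp add: H_def A_def m_def algebra_simps)
  have H_nonneg: "0 \<le> H j x" for j x
  proof (cases "0 < w x \<and> q * \<epsilon> j \<le> (1 + q) * w x")
    case True
    then have "0 \<le> q * (sqrt (u j x + \<epsilon> j) - sqrt (w x))\<^sup>2" using q by simp
    with H_ge True show ?thesis by (meson order_trans)
  next
    case False
    then have "w x = 0 \<or> m j x = (1 + q) * w x"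
      using w_nonneg[of x] by (auto simp: m_def)
    then show ?thesis
      using A_nonneg[of j x] m_nonneg[of j x] u_nonneg[of j x] q by (auto simp: H_def)
  qed
  have m_lim: "(\<lambda>j. \<integral>\<^sup>+x. ennreal (m j x) \<partial>M) \<longlonglongrightarrow> (\<integral>\<^sup>+x. 0 \<partial>M)"
  proof (rule nn_integral_dominated_convergence[where w = "\<lambda>x. ennreal ((1 + q) * w x)"])
    show "(\<integral>\<^sup>+x. ennreal ((1 + q) * w x) \<partial>M) < \<infinity>"
      using q w_nonneg w_mass by (simp add: ennreal_mult nn_integral_cmult ennreal_mult_less_top)
    show "AE x in M. (\<lambda>j. ennreal (m j x)) \<longlonglongrightarrow> 0"
    proof (intro AE_I2)
      fix x
      have "(\<lambda>j. m j x) \<longlonglongrightarrow> min (q * 0) ((1 + q) * w x)"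
        unfolding m_def by (intro tendsto_intros \<epsilon>)
      moreover have "min (q * 0) ((1 + q) * w x) = 0"
        using q w_nonneg[of x] by simp
      ultimately show "(\<lambda>j. ennreal (m j x)) \<longlonglongrightarrow> 0"
        using tendsto_ennrealI by fastforce
    qed
  qed (auto simp: m_def intro!: ennreal_leI)
  have H_le: "(\<integral>\<^sup>+x. ennreal (H j x) \<partial>M) \<le> (b j + ennreal q + (\<integral>\<^sup>+x. ennreal (m j x) \<partial>M)) - ennreal (1 + q)" for j
  proof -
    have "(\<integral>\<^sup>+x. ennreal (H j x) \<partial>M) + ennreal (1 + q) = (\<integral>\<^sup>+x. ennreal (H j x) \<partial>M) + (\<integral>\<^sup>+x. ennreal (1 + q) * ennreal (w x) \<partial>M)"
      using w_mass by (simp add: nn_integral_cmult)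
    also have "\<dots> = (\<integral>\<^sup>+x. ennreal (H j x) + ennreal (1 + q) * ennreal (w x) \<partial>M)"
      by (subst nn_integral_add) auto
    also have "\<dots> = (\<integral>\<^sup>+x. ennreal (A j x) + ennreal q * ennreal (u j x) + ennreal (m j x) \<partial>M)"
    proof (rule nn_integral_cong)
      fix x
      have "ennreal (H j x) + ennreal (1 + q) * ennreal (w x) = ennreal (H j x + (1 + q) * w x)"
        using q H_nonneg w_nonneg by (simp add: ennreal_mult ennreal_plus del: ennreal_plus[symmetric])
      also have "H j x + (1 + q) * w x = A j x + q * u j x + m j x"
        by (simp add: H_def)
      also have "ennreal \<dots> = ennreal (A j x) + ennreal q * ennreal (u j x) + ennreal (m j x)"
        using q A_nonneg m_nonneg u_nonneg by (simp add: ennreal_mult)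
      finally show "ennreal (H j x) + ennreal (1 + q) * ennreal (w x)
        = ennreal (A j x) + ennreal q * ennreal (u j x) + ennreal (m j x)" .
    qed
    also have "\<dots> = (\<integral>\<^sup>+x. ennreal (A j x) \<partial>M) + ennreal q * (\<integral>\<^sup>+x. ennreal (u j x) \<partial>M) + (\<integral>\<^sup>+x. ennreal (m j x) \<partial>M)"
      by (simp add: nn_integral_add nn_integral_cmult)
    also have "\<dots> \<le> b j + ennreal q * 1 + (\<integral>\<^sup>+x. ennreal (m j x) \<partial>M)"
      using energy[of j] u_mass[of j] unfolding A_def by (intro add_mono mult_left_mono) auto
    finally have "(\<integral>\<^sup>+x. ennreal (H j x) \<partial>M) + ennreal (1 + q) \<le> b j + ennreal q + (\<integral>\<^sup>+x. ennreal (m j x) \<partial>M)"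
      by simp
    then have "((\<integral>\<^sup>+x. ennreal (H j x) \<partial>M) + ennreal (1 + q)) - ennreal (1 + q)
      \<le> (b j + ennreal q + (\<integral>\<^sup>+x. ennreal (m j x) \<partial>M)) - ennreal (1 + q)"
      by (rule ennreal_minus_mono) simp
    then show ?thesis
      by (subst (asm) ennreal_add_diff_cancel_right) auto
  qed
  have "(\<lambda>j. (b j + ennreal q + (\<integral>\<^sup>+x. ennreal (m j x) \<partial>M)) - ennreal (1 + q)) \<longlonglongrightarrow> (1 + ennreal q + (\<integral>\<^sup>+x. 0 \<partial>M)) - ennreal (1 + q)"
    by (intro tendsto_diff_ennreal tendsto_add b m_lim tendsto_const) auto
  moreover have "(1 + ennreal q + (\<integral>\<^sup>+x. 0 \<partial>M)) - ennreal (1 + q) = 0"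
    using q by simp
  ultimately have B_lim: "(\<lambda>j. (b j + ennreal q + (\<integral>\<^sup>+x. ennreal (m j x) \<partial>M)) - ennreal (1 + q)) \<longlonglongrightarrow> 0"
    by simp
  have w_int: "integrable M w"
    using w_mass w_nonneg by (intro integrableI_nonneg) auto
  (* the first few H j may fail to be integrable; cutting them off at w loses nothing where w > 0 *)
  have int: "integrable M (\<lambda>x. min (H j x) (w x))" for j
    using H_nonneg w_nonneg by (intro Bochner_Integration.integrable_bound[OF w_int]) auto
  have eq: "ennreal (\<integral>x. norm (min (H j x) (w x)) \<partial>M) = (\<integral>\<^sup>+x. ennreal (min (H j x) (w x)) \<partial>M)" for j
    using int[of j] H_nonneg w_nonneg by (subst nn_integral_eq_integral) auto
  have "(\<lambda>j. ennreal (\<integral>x. norm (min (H j x) (w x)) \<partial>M)) \<longlonglongrightarrow> 0"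
  proof (rule tendsto_sandwich[OF _ _ tendsto_const B_lim])
    show "\<forall>\<^sub>F j in sequentially. ennreal (\<integral>x. norm (min (H j x) (w x)) \<partial>M)
        \<le> b j + ennreal q + (\<integral>\<^sup>+x. ennreal (m j x) \<partial>M) - ennreal (1 + q)"
    proof (intro always_eventually allI)
      fix j
      have "(\<integral>\<^sup>+x. ennreal (min (H j x) (w x)) \<partial>M) \<le> (\<integral>\<^sup>+x. ennreal (H j x) \<partial>M)"
        by (intro nn_integral_mono ennreal_leI) auto
      with H_le[of j] show "ennreal (\<integral>x. norm (min (H j x) (w x)) \<partial>M)
        \<le> b j + ennreal q + (\<integral>\<^sup>+x. ennreal (m j x) \<partial>M) - ennreal (1 + q)"
        unfolding eq by (rule order_trans[rotated])
    qed
  qed simp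
  then have "(\<lambda>j. \<integral>x. norm (min (H j x) (w x)) \<partial>M) \<longlonglongrightarrow> 0"
    by (subst (asm) ennreal_0[symmetric], subst (asm) tendsto_ennreal_iff) (auto intro!: always_eventually)
  then obtain k where k: "strict_mono k" and AE: "AE x in M. (\<lambda>j. min (H (k j) x) (w x)) \<longlonglongrightarrow> 0"
    using tendsto_L1_AE_subseq[of M "\<lambda>j x. min (H j x) (w x)", OF int] by blast
  have conv: "(\<lambda>j. u (k j) x + \<epsilon> (k j)) \<longlonglongrightarrow> w x"
    if wx: "0 < w x" and lim: "(\<lambda>j. min (H (k j) x) (w x)) \<longlonglongrightarrow> 0" for x
  proof -
    let ?D = "\<lambda>j. sqrt (u (k j) x + \<epsilon> (k j)) - sqrt (w x)"
    have \<epsilon>k: "(\<lambda>j. q * \<epsilon> (k j)) \<longlonglongrightarrow> 0"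
      using LIMSEQ_subseq_LIMSEQ[OF \<epsilon>(2) k] by (intro tendsto_mult_right_zero) (simp add: o_def)
    have "eventually (\<lambda>j. q * \<epsilon> (k j) < (1 + q) * w x) sequentially"
      by (rule order_tendstoD(2)[OF \<epsilon>k]) (use q wx in auto)
    moreover have "eventually (\<lambda>j. min (H (k j) x) (w x) < w x) sequentially"
      using lim wx by (rule order_tendstoD(2))
    ultimately have "eventually (\<lambda>j. q * (?D j)\<^sup>2 \<le> min (H (k j) x) (w x)) sequentially"
    proof eventually_elim
      case (elim j)
      then show ?case
        using H_ge[of x "k j"] wx by (auto simp: min_def split: if_splits)
    qed
    then have "(\<lambda>j. q * (?D j)\<^sup>2) \<longlonglongrightarrow> 0"
      using q by (intro tendsto_sandwich[OF _ _ tendsto_const lim]) (auto intro!: always_eventually)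
    then have "(\<lambda>j. inverse q * (q * (?D j)\<^sup>2)) \<longlonglongrightarrow> 0"
      by (rule tendsto_mult_right_zero)
    then have "(\<lambda>j. (?D j)\<^sup>2) \<longlonglongrightarrow> 0"
      using q by simp
    then have "?D \<longlonglongrightarrow> 0"
      using tendsto_real_sqrt[of "\<lambda>j. (?D j)\<^sup>2" 0 sequentially] by (simp add: tendsto_rabs_zero_iff)
    then have "(\<lambda>j. (?D j + sqrt (w x))\<^sup>2) \<longlonglongrightarrow> (0 + sqrt (w x))\<^sup>2"
      by (intro tendsto_intros)
    moreover have "(?D j + sqrt (w x))\<^sup>2 = u (k j) x + \<epsilon> (k j)" for j
      using u_nonneg[of "k j" x] \<epsilon>(1)[of "k j"] by simp
    ultimately show ?thesis
      using wx by simp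
  qed
  show ?thesis
    by (rule that[OF k]) (use AE conv in \<open>auto elim!: eventually_mono\<close>)
qed

section \<open>Finiteness of the power integral of the density\<close>

lemma nn_integral_one_plus_abs_powr_finite:
  fixes p :: real
  assumes "1 < p"
  shows "(\<integral>\<^sup>+t. ennreal ((1 + \<bar>t\<bar>) powr (- p)) \<partial>lborel) < \<infinity>"
proof -
  define F where "F = (\<lambda>t :: real. - ((1 + t) powr (1 - p)) / (p - 1))"
  have lim: "(F \<longlongrightarrow> 0) at_top"
    unfolding F_def using assms by real_asymp
  have half: "(\<integral>\<^sup>+t. ennreal ((1 + t) powr (- p)) * indicator {0..} t \<partial>lborel) = ennreal (0 - F 0)"
  proof (rule nn_integral_FTC_atLeast[OF _ _ _ lim])
    fix t :: real assume "0 \<le> t"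
    then have "((\<lambda>t. (1 + t) powr (1 - p)) has_real_derivative (1 - p) * (1 + t) powr (1 - p - 1) * 1) (at t)"
      by (intro DERIV_chain2[OF has_real_derivative_powr]) (auto intro!: derivative_eq_intros)
    then have "(F has_real_derivative - ((1 - p) * (1 + t) powr (1 - p - 1) * 1) / (p - 1)) (at t)"
      unfolding F_def by (intro DERIV_cdivide DERIV_minus)
    moreover have "- ((1 - p) * (1 + t) powr (1 - p - 1) * 1) / (p - 1) = (1 + t) powr (- p)"
    proof -
      have "- ((1 - p) * (1 + t) powr (1 - p - 1) * 1) = (1 + t) powr (- p) * (p - 1)"
        by (simp add: algebra_simps)
      then show ?thesis using assms by (simp only:) simp
    qed
    ultimately show "(F has_real_derivative (1 + t) powr (- p)) (at t)"
      by (rule DERIV_cong)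
  qed auto
  have "(\<integral>\<^sup>+t. ennreal ((1 + \<bar>t\<bar>) powr (- p)) \<partial>lborel)
    \<le> (\<integral>\<^sup>+t. ennreal ((1 + t) powr (- p)) * indicator {0..} t
        + ennreal ((1 + (0 + (-1) * t)) powr (- p)) * indicator {0..} (0 + (-1) * t) \<partial>lborel)"
  proof (rule nn_integral_mono)
    fix t :: real
    show "ennreal ((1 + \<bar>t\<bar>) powr (- p)) \<le> ennreal ((1 + t) powr (- p)) * indicator {0..} t
        + ennreal ((1 + (0 + (-1) * t)) powr (- p)) * indicator {0..} (0 + (-1) * t)"
      by (cases "0 \<le> t") auto
  qed
  also have "\<dots> = (\<integral>\<^sup>+t. ennreal ((1 + t) powr (- p)) * indicator {0..} t \<partial>lborel)
     + (\<integral>\<^sup>+t. ennreal ((1 + (0 + (-1) * t)) powr (- p)) * indicator {0..} (0 + (-1) * t) \<partial>lborel)"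
    by (subst nn_integral_add) auto
  also have "(\<integral>\<^sup>+t. ennreal ((1 + (0 + (-1) * t)) powr (- p)) * indicator {0..} (0 + (-1) * t) \<partial>lborel)
     = (\<integral>\<^sup>+t. ennreal ((1 + t) powr (- p)) * indicator {0..} t \<partial>lborel)"
    by (subst (2) nn_integral_real_affine[where c = "-1" and t = 0]) auto
  finally show ?thesis
    unfolding half by (auto simp: less_top[symmetric] top_unique)
qed

text \<open>
  A pointwise substitute for Hoelder's inequality: with a weight \<open>W\<close>, either the first term on the right
  dominates or \<open>y\<close> is bounded by a power of \<open>W\<close>.
\<close>
lemma powr_le_weighted:
  fixes y W \<nu> :: real
  assumes "0 \<le> y" "0 < W" "0 < \<nu>" "\<nu> < 1"
  shows "y powr \<nu> \<le> y * W + W powr (- (\<nu> / (1 - \<nu>)))"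
proof (cases "y powr \<nu> \<le> y * W")
  case False
  then have y: "0 < y" using assms by (cases "y = 0") auto
  have "y powr (1 - \<nu>) = y / y powr \<nu>"
    using y by (simp add: powr_diff)
  also have "\<dots> \<le> 1 / W"
    using False y assms by (simp add: field_simps)
  finally have "(y powr (1 - \<nu>)) powr (\<nu> / (1 - \<nu>)) \<le> (1 / W) powr (\<nu> / (1 - \<nu>))"
    using assms by (intro powr_mono2) auto
  then have "y powr \<nu> \<le> W powr (- (\<nu> / (1 - \<nu>)))"
    using assms by (simp add: powr_powr powr_divide powr_minus_divide)
  moreover have "0 \<le> y * W" using assms by simp
  ultimately show ?thesis by linarith
qed (use assms in \<open>simp add: add_increasing2\<close>)

context comparable_norm
begin

text \<open>
  The weight \<open>W\<close>, a product over the coordinates, is bounded by \<open>1 + N x powr p\<close> up to constants, and its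
  power \<open>- d / r\<close> is a product of functions \<open>(1 + \<bar>t\<bar>) powr (- (p / r))\<close> of one variable, integrable since
  \<open>p > r\<close>.
\<close>
lemma nn_integral_density_powr_finite:
  fixes f :: "real ^ 'n \<Rightarrow> real" and r p :: real
  assumes f [measurable]: "f \<in> borel_measurable borel" and f_nonneg: "\<And>x. 0 \<le> f x"
    and r: "0 < r" "r < p"
    and mass: "(\<integral>\<^sup>+x. ennreal (f x) \<partial>lborel) < \<infinity>"
    and moment: "(\<integral>\<^sup>+x. ennreal (f x * N x powr p) \<partial>lborel) < \<infinity>"
  shows "(\<integral>\<^sup>+x. ennreal (f x powr (CARD('n) / (CARD('n) + r))) \<partial>lborel) < \<infinity>"
proof -
  define d where "d = CARD('n)"
  have d: "0 < d" by (simp add: d_def)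
  define \<nu> where "\<nu> = d / (d + r)"
  have \<nu>: "0 < \<nu>" "\<nu> < 1" "\<nu> / (1 - \<nu>) = d / r"
  proof -
    have "1 - \<nu> = r / (d + r)"
      using d r by (simp add: \<nu>_def field_simps)
    then show "\<nu> / (1 - \<nu>) = d / r"
      using d r by (simp add: \<nu>_def)
  qed (use d r in \<open>auto simp: \<nu>_def\<close>)
  define W where "W = (\<lambda>x :: real ^ 'n. \<Prod>b\<in>Basis. (1 + \<bar>x \<bullet> b\<bar>) powr (p / d))"
  have W_pos: "0 < W x" for x
    unfolding W_def by (intro prod_pos) auto
  have [measurable]: "W \<in> borel_measurable borel"
    unfolding W_def by measurable
  have W_le: "W x \<le> 2 powr p * (1 + (1 / lo) powr p * N x powr p)" for x
  proof -
    have "W x \<le> (\<Prod>b\<in>(Basis :: (real ^ 'n) set). (1 + N x / lo) powr (p / d))"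
      unfolding W_def
    proof (intro prod_mono conjI powr_mono2)
      fix b :: "real ^ 'n" assume "b \<in> Basis"
      then obtain i where "b = axis i 1" by (auto simp: Basis_vec_def)
      then show "1 + \<bar>x \<bullet> b\<bar> \<le> 1 + N x / lo"
        using lo_le[of x i] lo_pos by (simp add: inner_axis field_simps)
    qed (use r d in auto)
    also have "\<dots> = ((1 + N x / lo) powr (p / d)) ^ d"
      by (simp add: d_def)
    also have "\<dots> = (1 + N x / lo) powr p"
    proof -
      have "0 < 1 + N x / lo"
        using N_nonneg[of x] lo_pos by (intro add_pos_nonneg) auto
      then show ?thesis
        using d by (subst powr_realpow[symmetric]) (auto simp: powr_powr)
    qed
    also have "\<dots> \<le> (2 * max 1 (N x / lo)) powr p"
      using N_nonneg[of x] lo_pos r by (intro powr_mono2) auto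
    also have "\<dots> = 2 powr p * max 1 (N x / lo) powr p"
      by (simp add: powr_mult)
    also have "max 1 (N x / lo) powr p \<le> 1 + (N x / lo) powr p"
      by (auto simp: max_def)
    also have "(N x / lo) powr p = (1 / lo) powr p * N x powr p"
      using lo_pos by (simp add: powr_divide)
    finally show ?thesis by simp
  qed
  have "(\<integral>\<^sup>+x. ennreal (f x powr \<nu>) \<partial>lborel)
      \<le> (\<integral>\<^sup>+x. ennreal (2 powr p) * (ennreal (f x) + ennreal ((1 / lo) powr p) * ennreal (f x * N x powr p))
          + ennreal (W x powr (- (d / r))) \<partial>lborel)"
  proof (rule nn_integral_mono)
    fix x
    have "f x powr \<nu> \<le> f x * W x + W x powr (- (d / r))"
      using powr_le_weighted[OF f_nonneg W_pos \<nu>(1,2)] unfolding \<nu>(3) .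
    also have "\<dots> \<le> f x * (2 powr p * (1 + (1 / lo) powr p * N x powr p)) + W x powr (- (d / r))"
      using W_le f_nonneg by (intro add_right_mono mult_left_mono)
    also have "\<dots> = 2 powr p * (f x + (1 / lo) powr p * (f x * N x powr p)) + W x powr (- (d / r))"
      by (simp add: algebra_simps)
    finally have "ennreal (f x powr \<nu>) \<le> ennreal (2 powr p * (f x + (1 / lo) powr p * (f x * N x powr p)) + W x powr (- (d / r)))"
      by (rule ennreal_leI)
    also have "\<dots> = ennreal (2 powr p) * (ennreal (f x) + ennreal ((1 / lo) powr p) * ennreal (f x * N x powr p))
          + ennreal (W x powr (- (d / r)))"
      using f_nonneg[of x] by (simp add: ennreal_mult)
    finally show "ennreal (f x powr \<nu>) \<le> ennreal (2 powr p) * (ennreal (f x) + ennreal ((1 / lo) powr p) * ennreal (f x * N x powr p))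
          + ennreal (W x powr (- (d / r)))" .
  qed
  also have "\<dots> = ennreal (2 powr p) * ((\<integral>\<^sup>+x. ennreal (f x) \<partial>lborel)
        + ennreal ((1 / lo) powr p) * (\<integral>\<^sup>+x. ennreal (f x * N x powr p) \<partial>lborel))
        + (\<integral>\<^sup>+x. ennreal (W x powr (- (d / r))) \<partial>lborel)"
    by (simp add: nn_integral_add nn_integral_cmult)
  also have "(\<integral>\<^sup>+x. ennreal (W x powr (- (d / r))) \<partial>lborel)
      = (\<integral>\<^sup>+x. (\<Prod>b\<in>Basis. ennreal ((1 + \<bar>x \<bullet> b\<bar>) powr (- (p / r)))) \<partial>(lborel :: (real ^ 'n) measure))"
  proof (rule nn_integral_cong)
    fix x :: "real ^ 'n"
    have "W x powr (- (d / r)) = (\<Prod>b\<in>Basis. ((1 + \<bar>x \<bullet> b\<bar>) powr (p / d)) powr (- (d / r)))"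
      unfolding W_def by (rule prod_powr_distrib)
    also have "\<dots> = (\<Prod>b\<in>Basis. (1 + \<bar>x \<bullet> b\<bar>) powr (- (p / r)))"
      using d by (intro prod.cong) (auto simp: powr_powr)
    finally show "ennreal (W x powr (- (d / r))) = (\<Prod>b\<in>Basis. ennreal ((1 + \<bar>x \<bullet> b\<bar>) powr (- (p / r))))"
      by (simp add: prod_ennreal)
  qed
  also have "\<dots> = (\<Prod>b\<in>(Basis :: (real ^ 'n) set). (\<integral>\<^sup>+t. ennreal ((1 + \<bar>t\<bar>) powr (- (p / r))) \<partial>lborel))"
    by (rule nn_integral_lborel_prod) auto
  finally have "(\<integral>\<^sup>+x. ennreal (f x powr \<nu>) \<partial>lborel) \<le> ennreal (2 powr p) * ((\<integral>\<^sup>+x. ennreal (f x) \<partial>lborel)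
        + ennreal ((1 / lo) powr p) * (\<integral>\<^sup>+x. ennreal (f x * N x powr p) \<partial>lborel))
        + (\<Prod>b\<in>(Basis :: (real ^ 'n) set). (\<integral>\<^sup>+t. ennreal ((1 + \<bar>t\<bar>) powr (- (p / r))) \<partial>lborel))" .
  also have "\<dots> < \<infinity>"
    using nn_integral_one_plus_abs_powr_finite[of "p / r"] mass moment r
    by (auto simp: ennreal_mult_less_top power_less_top_ennreal)
  finally show ?thesis
    unfolding \<nu>_def d_def .
qed

end

section \<open>Lower bounds for mismatched distortion\<close>

context comparable_norm
begin

text \<open>
  The averaged lower bound is applied twice, to \<open>f\<close> with exponent \<open>r\<close> and to \<open>g\<close> with exponent \<open>s\<close>, with
  the same cubes, truncation levels and numbers of points. The first application and the asymptotic
  optimality make the local densities almost optimal for the energy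
  \<open>\<integral> f u powr (- (r / d))\<close>, hence convergent almost everywhere on \<open>{f > 0}\<close>, along a subsequence, to the
  density \<open>w\<close> proportional to \<open>f powr (d / (d + r))\<close>; in the second one Fatou's lemma passes to the limit.
  The majorant \<open>a\<close> stands for the rescaled distortion of a measure whose absolutely continuous part has density \<open>f\<close>.
\<close>
lemma mismatched_distortion_lower_bound:
  fixes f g :: "real ^ 'n \<Rightarrow> real" and r s I :: real and \<alpha> :: "nat \<Rightarrow> (real ^ 'n) set"
    and a :: "nat \<Rightarrow> ennreal"
  defines "d \<equiv> real CARD('n)"
  assumes rs: "0 < r" "0 < s"
    and f: "integrable lborel f" "\<And>x. 0 \<le> f x"
    and g: "integrable lborel g" "\<And>x. 0 \<le> g x"
    and I: "(\<integral>\<^sup>+x. ennreal (f x powr (d / (d + r))) \<partial>lborel) = ennreal I" "0 < I"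
    and \<alpha>: "\<And>n. 1 \<le> n \<Longrightarrow> quantizer n (\<alpha> n)"
    and a_ge: "\<And>n. 1 \<le> n \<Longrightarrow>
      ennreal (real n powr (r / d)) * (\<integral>\<^sup>+x. ennreal (f x * set_dist N x (\<alpha> n) powr r) \<partial>lborel) \<le> a n"
    and a_lim: "a \<longlonglongrightarrow> quant_const N r * ennreal (I powr ((d + r) / d))"
  shows "quant_const N s * (ennreal (I powr (s / d)) *
      (\<integral>\<^sup>+x \<in> {x. 0 < f x}. ennreal (g x * f x powr (- (s / (d + r)))) \<partial>lborel))
    \<le> liminf (\<lambda>n. ennreal (real n powr (s / d)) *
        (\<integral>\<^sup>+x. ennreal (g x * set_dist N x (\<alpha> n) powr s) \<partial>lborel))"
proof -
  define L where "L = (\<lambda>n. ennreal (real n powr (s / d)) *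
        (\<integral>\<^sup>+x. ennreal (g x * set_dist N x (\<alpha> n) powr s) \<partial>lborel))"
  have d: "0 < d" by (simp add: d_def)
  have [measurable]: "f \<in> borel_measurable borel" "g \<in> borel_measurable borel"
    using f g by auto
  have fin: "finite (\<alpha> n)" "\<alpha> n \<noteq> {}" "card (\<alpha> n) \<le> n" if "1 \<le> n" for n
    using \<alpha>[OF that] by (auto simp: quantizer_def)
  obtain Jr where Jr: "quant_const N r = ennreal Jr" "0 < Jr"
    using quant_const_finite[OF rs(1)] quant_const_pos[OF rs(1)] by (cases "quant_const N r") auto
  obtain \<sigma> where \<sigma>: "strict_mono \<sigma>" "(L \<circ> \<sigma>) \<longlonglongrightarrow> liminf L"
    using liminf_subseq_lim[of L] by auto

  \<comment> \<open>The parameters are chosen in this order: the truncation level \<open>\<tau> j\<close>, which fixes the weight of the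
    \<open>L\<^sup>1\<close> errors; the side \<open>h j\<close>, which makes both errors small; and \<open>n j\<close>, so large that \<open>\<kappa> j\<close> is small,
    taken from a subsequence that realizes the lower limit.\<close>
  define \<tau> where "\<tau> = (\<lambda>j. real j + 1)"
  have \<tau>: "0 < \<tau> j" for j by (simp add: \<tau>_def add_pos_nonneg)
  let ?\<eta> = "\<lambda>j. ennreal (1 / (real j + 1))"
  have "\<forall>j. \<exists>h>0. ennreal (\<tau> j powr r) * (\<integral>\<^sup>+x. ennreal \<bar>cube_average h f x - f x\<bar> \<partial>lborel) \<le> ?\<eta> j \<and>
      ennreal (\<tau> j powr s) * (\<integral>\<^sup>+x. ennreal \<bar>cube_average h g x - g x\<bar> \<partial>lborel) \<le> ?\<eta> j"
  proof
    fix j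
    have small: "eventually (\<lambda>k. ennreal (\<tau> j powr p) *
        (\<integral>\<^sup>+x. ennreal \<bar>cube_average (inverse (real (Suc k))) F x - F x\<bar> \<partial>lborel) < ?\<eta> j) sequentially"
      if F: "integrable lborel F" "\<And>x. 0 \<le> F x" for p and F :: "real ^ 'n \<Rightarrow> real"
    proof (rule order_tendstoD(2))
      show "(\<lambda>k. ennreal (\<tau> j powr p) *
        (\<integral>\<^sup>+x. ennreal \<bar>cube_average (inverse (real (Suc k))) F x - F x\<bar> \<partial>lborel)) \<longlonglongrightarrow> ennreal (\<tau> j powr p) * 0"
        by (intro ennreal_tendsto_cmult cube_average_L1_tendsto F) simp
    qed simp
    have "eventually (\<lambda>k. ennreal (\<tau> j powr r) *
          (\<integral>\<^sup>+x. ennreal \<bar>cube_average (inverse (real (Suc k))) f x - f x\<bar> \<partial>lborel) < ?\<eta> j \<and>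
        ennreal (\<tau> j powr s) *
          (\<integral>\<^sup>+x. ennreal \<bar>cube_average (inverse (real (Suc k))) g x - g x\<bar> \<partial>lborel) < ?\<eta> j) sequentially"
      using small[OF f, of r] small[OF g, of s] by (rule eventually_conj)
    then obtain k where k: "ennreal (\<tau> j powr r) *
          (\<integral>\<^sup>+x. ennreal \<bar>cube_average (inverse (real (Suc k))) f x - f x\<bar> \<partial>lborel) < ?\<eta> j"
        "ennreal (\<tau> j powr s) *
          (\<integral>\<^sup>+x. ennreal \<bar>cube_average (inverse (real (Suc k))) g x - g x\<bar> \<partial>lborel) < ?\<eta> j"
      unfolding eventually_sequentially by blast
    show "\<exists>h>0. ennreal (\<tau> j powr r) * (\<integral>\<^sup>+x. ennreal \<bar>cube_average h f x - f x\<bar> \<partial>lborel) \<le> ?\<eta> j \<and>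
      ennreal (\<tau> j powr s) * (\<integral>\<^sup>+x. ennreal \<bar>cube_average h g x - g x\<bar> \<partial>lborel) \<le> ?\<eta> j"
      using k[THEN less_imp_le] by (intro exI[of _ "inverse (real (Suc k))"] conjI) simp_all
  qed
  from choice[OF this] obtain h where h: "\<And>j. 0 < h j"
    and h_f: "\<And>j. ennreal (\<tau> j powr r) * (\<integral>\<^sup>+x. ennreal \<bar>cube_average (h j) f x - f x\<bar> \<partial>lborel) \<le> ?\<eta> j"
    and h_g: "\<And>j. ennreal (\<tau> j powr s) * (\<integral>\<^sup>+x. ennreal \<bar>cube_average (h j) g x - g x\<bar> \<partial>lborel) \<le> ?\<eta> j"
    by blast
  have "\<forall>j. \<exists>i\<ge>j. 1 \<le> \<sigma> i \<and> \<tau> j * real (\<sigma> i) powr (- (1 / d)) / h j < min 1 (lo / (2 * (real j + 2)))"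
  proof
    fix j
    have "(\<lambda>i. \<tau> j * real (\<sigma> i) powr (- (1 / d)) / h j) \<longlonglongrightarrow> \<tau> j * 0 / h j"
      using \<sigma>(1) d h[of j]
      by (intro tendsto_intros tendsto_neg_powr filterlim_compose[OF filterlim_real_sequentially filterlim_subseq]) auto
    then have "eventually (\<lambda>i. \<tau> j * real (\<sigma> i) powr (- (1 / d)) / h j < min 1 (lo / (2 * (real j + 2)))) sequentially"
      using lo_pos by (intro order_tendstoD(2)) (auto simp: add_nonneg_pos)
    moreover have "eventually (\<lambda>i. j \<le> i \<and> 1 \<le> i) sequentially"
      by (intro eventually_conj eventually_ge_at_top)
    ultimately have "eventually (\<lambda>i. \<tau> j * real (\<sigma> i) powr (- (1 / d)) / h j < min 1 (lo / (2 * (real j + 2)))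
        \<and> j \<le> i \<and> 1 \<le> i) sequentially"
      by (rule eventually_conj)
    then obtain i where "\<tau> j * real (\<sigma> i) powr (- (1 / d)) / h j < min 1 (lo / (2 * (real j + 2)))" "j \<le> i" "1 \<le> i"
      unfolding eventually_sequentially by blast
    moreover from this have "1 \<le> \<sigma> i"
      using seq_suble[OF \<sigma>(1), of i] by linarith
    ultimately show "\<exists>i\<ge>j. 1 \<le> \<sigma> i \<and> \<tau> j * real (\<sigma> i) powr (- (1 / d)) / h j < min 1 (lo / (2 * (real j + 2)))"
      by blast
  qed
  from choice[OF this] obtain i where i: "\<And>j. j \<le> i j" "\<And>j. 1 \<le> \<sigma> (i j)"
    and i_small: "\<And>j. \<tau> j * real (\<sigma> (i j)) powr (- (1 / d)) / h j < min 1 (lo / (2 * (real j + 2)))"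
    by blast
  define n where "n = (\<lambda>j. \<sigma> (i j))"
  have n: "1 \<le> n j" for j using i by (simp add: n_def)
  define \<kappa> where "\<kappa> = (\<lambda>j. \<tau> j * real (n j) powr (- (1 / d)) / h j)"
  have \<kappa>: "0 < \<kappa> j" "\<kappa> j < 1" "2 * \<kappa> j / lo < 1 / (real j + 2)" "2 * \<kappa> j < lo" for j
  proof -
    show "0 < \<kappa> j" "\<kappa> j < 1"
      using \<tau>[of j] h[of j] n[of j] i_small[of j] by (auto simp: \<kappa>_def n_def)
    have "\<kappa> j < lo / (2 * (real j + 2))"
      using i_small[of j] by (simp add: \<kappa>_def n_def)
    then show *: "2 * \<kappa> j / lo < 1 / (real j + 2)"
      using lo_pos by (simp add: field_simps)
    have "1 / (real j + 2) \<le> 1" by simp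
    with * have "2 * \<kappa> j / lo < 1" by linarith
    then show "2 * \<kappa> j < lo"
      using lo_pos by simp
  qed
  have i_lim: "filterlim i at_top sequentially"
    using i(1) by (intro filterlim_at_top_mono[OF filterlim_ident]) auto
  have n_lim: "filterlim n at_top sequentially"
    unfolding n_def using filterlim_compose[OF filterlim_subseq[OF \<sigma>(1)] i_lim] .
  have L_lim: "(\<lambda>j. L (n j)) \<longlonglongrightarrow> liminf L"
    unfolding n_def using filterlim_compose[OF \<sigma>(2) i_lim] by simp
  have \<eta>_lim: "?\<eta> \<longlonglongrightarrow> 0"
  proof -
    have "(\<lambda>j. 1 / (real j + 1)) \<longlonglongrightarrow> 0" by real_asymp
    then show ?thesis by (auto dest: tendsto_ennrealI)
  qed
  have \<kappa>_lim: "(\<lambda>j. 2 * \<kappa> j / lo) \<longlonglongrightarrow> 0"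
  proof (rule tendsto_sandwich[OF _ _ tendsto_const])
    show "(\<lambda>j. 1 / (real j + 2)) \<longlonglongrightarrow> 0" by real_asymp
  qed (use \<kappa> lo_pos in \<open>auto intro!: always_eventually less_imp_le\<close>)
  define c where "c = (\<lambda>p j. (1 - 2 * \<kappa> j / lo) powr (p + d))"
  have c_pos: "0 < c p j" for p j
    unfolding c_def using \<kappa>(4)[of j] lo_pos by simp
  have c_lim: "c p \<longlonglongrightarrow> 1" for p
  proof -
    have "(\<lambda>j. (1 - 2 * \<kappa> j / lo) powr (p + d)) \<longlonglongrightarrow> (1 - 0) powr (p + d)"
      by (intro tendsto_intros \<kappa>_lim) auto
    then show ?thesis by (simp add: c_def)
  qed
  define \<epsilon> where "\<epsilon> = (\<lambda>j. ((hi + \<kappa> j) / \<tau> j) ^ CARD('n))"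
  have \<epsilon>_pos: "0 < \<epsilon> j" for j
    unfolding \<epsilon>_def using hi_pos \<kappa>(1)[of j] \<tau>[of j] by simp
  have \<epsilon>_lim: "\<epsilon> \<longlonglongrightarrow> 0"
  proof -
    have "(\<lambda>j. (hi + \<kappa> j) / \<tau> j) \<longlonglongrightarrow> 0"
    proof (rule tendsto_sandwich[OF _ _ tendsto_const])
      show "(\<lambda>j. (hi + 1) / \<tau> j) \<longlonglongrightarrow> 0"
        unfolding \<tau>_def by real_asymp
      have "0 \<le> (hi + \<kappa> j) / \<tau> j" "(hi + \<kappa> j) / \<tau> j \<le> (hi + 1) / \<tau> j" for j
        using \<kappa>(1,2)[of j] \<tau>[of j] hi_pos by (auto intro!: divide_right_mono)
      then show "\<forall>\<^sub>F j in sequentially. 0 \<le> (hi + \<kappa> j) / \<tau> j"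
        "\<forall>\<^sub>F j in sequentially. (hi + \<kappa> j) / \<tau> j \<le> (hi + 1) / \<tau> j"
        by auto
    qed
    then have "\<epsilon> \<longlonglongrightarrow> 0 ^ CARD('n)"
      unfolding \<epsilon>_def by (rule tendsto_power)
    then show ?thesis by (simp add: power_0_left)
  qed
  define u where "u = (\<lambda>j. local_density (\<alpha> (n j)) (n j) (h j))"
  have u [measurable]: "u j \<in> borel_measurable borel" for j
    unfolding u_def using fin n by (intro measurable_local_density) auto
  have u_nonneg: "0 \<le> u j x" for j x
    unfolding u_def using h by (intro local_density_nonneg) (auto intro: less_imp_le)
  have u_mass: "(\<integral>\<^sup>+x. ennreal (u j x) \<partial>lborel) \<le> 1" for j
    unfolding u_def using fin n h by (intro local_density_mass) auto
  have bound_f: "quant_const N r * (\<integral>\<^sup>+y. ennreal (c r j * (f y * (u j y + \<epsilon> j) powr (- (r / d)))) \<partial>lborel)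
      \<le> a (n j) + ?\<eta> j" for j
  proof -
    have "quant_const N r * (\<integral>\<^sup>+y. ennreal (c r j * (f y * (u j y + \<epsilon> j) powr (- (r / d)))) \<partial>lborel)
      \<le> ennreal (real (n j) powr (r / d)) * (\<integral>\<^sup>+x. ennreal (f x * set_dist N x (\<alpha> (n j)) powr r) \<partial>lborel)
      + ennreal (\<tau> j powr r) * (\<integral>\<^sup>+x. ennreal \<bar>cube_average (h j) f x - f x\<bar> \<partial>lborel)"
      unfolding c_def u_def \<epsilon>_def d_def
      by (rule averaged_lower_bound) (use rs n fin f h \<tau> \<kappa>(4) in \<open>auto simp: \<kappa>_def d_def\<close>)
    also have "\<dots> \<le> a (n j) + ?\<eta> j"
      by (intro add_mono a_ge n h_f)
    finally show ?thesis .
  qed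
  have bound_g: "quant_const N s * (\<integral>\<^sup>+y. ennreal (c s j * (g y * (u j y + \<epsilon> j) powr (- (s / d)))) \<partial>lborel)
      \<le> L (n j) + ?\<eta> j" for j
  proof -
    have "quant_const N s * (\<integral>\<^sup>+y. ennreal (c s j * (g y * (u j y + \<epsilon> j) powr (- (s / d)))) \<partial>lborel)
      \<le> ennreal (real (n j) powr (s / d)) * (\<integral>\<^sup>+x. ennreal (g x * set_dist N x (\<alpha> (n j)) powr s) \<partial>lborel)
      + ennreal (\<tau> j powr s) * (\<integral>\<^sup>+x. ennreal \<bar>cube_average (h j) g x - g x\<bar> \<partial>lborel)"
      unfolding c_def u_def \<epsilon>_def d_def
      by (rule averaged_lower_bound) (use rs n fin g h \<tau> \<kappa>(4) in \<open>auto simp: \<kappa>_def d_def\<close>)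
    also have "\<dots> \<le> L (n j) + ?\<eta> j"
      unfolding L_def by (intro add_mono order_refl h_g)
    finally show ?thesis .
  qed

  \<comment> \<open>With \<open>1 + q = (d + r) / d\<close> one has \<open>w powr (1 + q) = f / I powr (1 + q)\<close>, so that the energy of
    \<open>u + \<epsilon>\<close> is a multiple of the integral in \<open>bound_f\<close>; asymptotic optimality makes its bound \<open>b j\<close> tend to 1.\<close>
  define q where "q = r / d"
  have q: "0 < q" using rs d by (simp add: q_def)
  define w where "w = (\<lambda>x. f x powr (d / (d + r)) / I)"
  have [measurable]: "w \<in> borel_measurable borel"
    unfolding w_def by measurable
  have w_nonneg: "0 \<le> w x" for x
    using I by (simp add: w_def)
  have w_mass: "(\<integral>\<^sup>+x. ennreal (w x) \<partial>lborel) = 1"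
  proof -
    have "(\<integral>\<^sup>+x. ennreal (w x) \<partial>lborel) = (\<integral>\<^sup>+x. ennreal (1 / I) * ennreal (f x powr (d / (d + r))) \<partial>lborel)"
      using I by (intro nn_integral_cong) (simp add: w_def flip: ennreal_mult)
    also have "\<dots> = ennreal (1 / I) * ennreal I"
      by (simp add: nn_integral_cmult I)
    also have "\<dots> = 1"
      using I by (simp flip: ennreal_mult)
    finally show ?thesis .
  qed
  have w_powr: "w x powr (1 + q) = f x / I powr (1 + q)" for x
  proof -
    have "1 + q = (d + r) / d" "d + r \<noteq> 0"
      using d rs by (simp_all add: q_def add_divide_distrib)
    then have exponent: "d / (d + r) * (1 + q) = 1"
      using d by simp
    have "w x powr (1 + q) = f x powr (d / (d + r) * (1 + q)) / I powr (1 + q)"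
      unfolding w_def using I(2) f(2)[of x] by (subst powr_divide) (simp_all add: powr_powr)
    then show ?thesis
      unfolding exponent using f(2)[of x] by simp
  qed
  define b where "b = (\<lambda>j. ennreal (1 / (I powr (1 + q) * (c r j * Jr))) * (a (n j) + ?\<eta> j))"
  have energy: "(\<integral>\<^sup>+x. ennreal (w x powr (1 + q) * (u j x + \<epsilon> j) powr (- q)) \<partial>lborel) \<le> b j" for j
  proof -
    let ?K = "1 / (I powr (1 + q) * (c r j * Jr))"
    have "(\<integral>\<^sup>+x. ennreal (w x powr (1 + q) * (u j x + \<epsilon> j) powr (- q)) \<partial>lborel)
      = (\<integral>\<^sup>+x. ennreal (?K * Jr) * ennreal (c r j * (f x * (u j x + \<epsilon> j) powr (- q))) \<partial>lborel)"
    proof (rule nn_integral_cong)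
      fix x
      have "w x powr (1 + q) * (u j x + \<epsilon> j) powr (- q) = ?K * Jr * (c r j * (f x * (u j x + \<epsilon> j) powr (- q)))"
        using w_powr[of x] c_pos[of r j] Jr I by simp
      then show "ennreal (w x powr (1 + q) * (u j x + \<epsilon> j) powr (- q))
        = ennreal (?K * Jr) * ennreal (c r j * (f x * (u j x + \<epsilon> j) powr (- q)))"
        using c_pos[of r j] Jr I f(2)[of x] by (simp only: ennreal_mult[symmetric])
          (subst ennreal_mult[symmetric]; simp)
    qed
    also have "\<dots> = ennreal (?K * Jr) * (\<integral>\<^sup>+x. ennreal (c r j * (f x * (u j x + \<epsilon> j) powr (- q))) \<partial>lborel)"
      by (rule nn_integral_cmult) measurable
    also have "ennreal (?K * Jr) = ennreal ?K * ennreal Jr"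
      using c_pos[of r j] Jr I by (intro ennreal_mult) auto
    also have "ennreal ?K * ennreal Jr * (\<integral>\<^sup>+x. ennreal (c r j * (f x * (u j x + \<epsilon> j) powr (- q))) \<partial>lborel) \<le> b j"
      unfolding b_def mult.assoc using bound_f[of j] by (intro mult_left_mono) (auto simp: Jr q_def)
    finally show ?thesis .
  qed
  have b_lim: "b \<longlonglongrightarrow> 1"
  proof -
    have an: "(\<lambda>j. a (n j)) \<longlonglongrightarrow> ennreal (Jr * I powr (1 + q))"
    proof -
      have "(d + r) / d = 1 + q" using d by (simp add: q_def add_divide_distrib)
      then show ?thesis
        using filterlim_compose[OF a_lim n_lim] Jr by (simp add: ennreal_mult)
    qed
    have "(\<lambda>j. 1 / (I powr (1 + q) * (c r j * Jr))) \<longlonglongrightarrow> 1 / (I powr (1 + q) * (1 * Jr))"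
      using I Jr by (intro tendsto_intros c_lim) auto
    then have "(\<lambda>j. ennreal (1 / (I powr (1 + q) * (c r j * Jr)))) \<longlonglongrightarrow> ennreal (1 / (I powr (1 + q) * (1 * Jr)))"
      by (rule tendsto_ennrealI)
    then have "b \<longlonglongrightarrow> ennreal (1 / (I powr (1 + q) * (1 * Jr))) * (ennreal (Jr * I powr (1 + q)) + 0)"
      unfolding b_def by (intro tendsto_mult_ennreal tendsto_add an \<eta>_lim) auto
    also have "ennreal (1 / (I powr (1 + q) * (1 * Jr))) * (ennreal (Jr * I powr (1 + q)) + 0) = 1"
      using I Jr by (simp flip: ennreal_mult)
    finally show ?thesis .
  qed
  obtain k where k: "strict_mono k"
    and AE_lim: "AE x in lborel. 0 < w x \<longrightarrow> (\<lambda>j. u (k j) x + \<epsilon> (k j)) \<longlonglongrightarrow> w x"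
    by (rule stability_of_optimal_density[where w = w and u = u and \<epsilon> = \<epsilon> and b = b and q = q and M = lborel])
       (use w_nonneg w_mass u_nonneg u_mass \<epsilon>_pos \<epsilon>_lim q energy b_lim in auto)

  define G where "G = (\<lambda>j x. quant_const N s * ennreal (c s j * (g x * (u j x + \<epsilon> j) powr (- (s / d)))))"
  have [measurable]: "G j \<in> borel_measurable borel" for j
    unfolding G_def by measurable
  have Js: "quant_const N s < top"
    using quant_const_finite[OF rs(2)] by simp
  have "quant_const N s * (ennreal (I powr (s / d)) *
      (\<integral>\<^sup>+x \<in> {x. 0 < f x}. ennreal (g x * f x powr (- (s / (d + r)))) \<partial>lborel))
    = (\<integral>\<^sup>+x. quant_const N s * (ennreal (I powr (s / d)) *
      (ennreal (g x * f x powr (- (s / (d + r)))) * indicator {x. 0 < f x} x)) \<partial>lborel)"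
    by (simp add: nn_integral_cmult)
  also have "\<dots> \<le> (\<integral>\<^sup>+x. liminf (\<lambda>j. G (k j) x) \<partial>lborel)"
  proof (rule nn_integral_mono_AE, use AE_lim in eventually_elim)
    fix x assume lim: "0 < w x \<longrightarrow> (\<lambda>j. u (k j) x + \<epsilon> (k j)) \<longlonglongrightarrow> w x"
    show "quant_const N s * (ennreal (I powr (s / d)) *
      (ennreal (g x * f x powr (- (s / (d + r)))) * indicator {x. 0 < f x} x)) \<le> liminf (\<lambda>j. G (k j) x)"
    proof (cases "0 < f x")
      case True
      then have wx: "0 < w x" using I by (simp add: w_def)
      have ck: "(\<lambda>j. c s (k j)) \<longlonglongrightarrow> 1"
        using LIMSEQ_subseq_LIMSEQ[OF c_lim k] by (simp add: o_def)
      have "(\<lambda>j. c s (k j) * (g x * (u (k j) x + \<epsilon> (k j)) powr (- (s / d)))) \<longlonglongrightarrow> 1 * (g x * w x powr (- (s / d)))"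
        using lim wx by (intro tendsto_intros ck) auto
      then have "(\<lambda>j. G (k j) x) \<longlonglongrightarrow> quant_const N s * ennreal (1 * (g x * w x powr (- (s / d))))"
        unfolding G_def by (intro ennreal_tendsto_cmult Js tendsto_ennrealI)
      then have "liminf (\<lambda>j. G (k j) x) = quant_const N s * ennreal (1 * (g x * w x powr (- (s / d))))"
        by (intro lim_imp_Liminf) auto
      moreover have "w x powr (- (s / d)) = I powr (s / d) * f x powr (- (s / (d + r)))"
      proof -
        have "w x powr (- (s / d)) = (f x powr (d / (d + r))) powr (- (s / d)) * I powr (s / d)"
          using I by (simp add: w_def powr_divide powr_minus field_simps)
        also have "(f x powr (d / (d + r))) powr (- (s / d)) = f x powr (- (s / (d + r)))"
          using d rs by (simp add: powr_powr)
        finally show ?thesis by simp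
      qed
      moreover have "ennreal (1 * (g x * (I powr (s / d) * f x powr (- (s / (d + r))))))
        = ennreal (I powr (s / d)) * ennreal (g x * f x powr (- (s / (d + r))))"
        using g(2)[of x] by (subst ennreal_mult[symmetric]) (auto simp: mult_ac)
      ultimately show ?thesis
        using True by simp
    qed simp
  qed
  also have "\<dots> \<le> liminf (\<lambda>j. \<integral>\<^sup>+x. G (k j) x \<partial>lborel)"
    by (rule nn_integral_liminf) simp
  also have "\<dots> \<le> liminf (\<lambda>j. L (n (k j)) + ?\<eta> (k j))"
  proof (intro Liminf_mono always_eventually allI)
    fix j
    show "(\<integral>\<^sup>+x. G (k j) x \<partial>lborel) \<le> L (n (k j)) + ?\<eta> (k j)"
      unfolding G_def using bound_g[of "k j"] by (subst nn_integral_cmult) auto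
  qed
  also have "\<dots> = liminf L"
  proof (intro lim_imp_Liminf)
    have "(\<lambda>j. L (n (k j)) + ?\<eta> (k j)) \<longlonglongrightarrow> liminf L + 0"
      using LIMSEQ_subseq_LIMSEQ[OF L_lim k] LIMSEQ_subseq_LIMSEQ[OF \<eta>_lim k]
      by (intro tendsto_add) (auto simp: o_def)
    then show "(\<lambda>j. L (n (k j)) + ?\<eta> (k j)) \<longlonglongrightarrow> liminf L" by simp
  qed simp
  finally show ?thesis
    unfolding L_def .
qed

end

lemma nn_integral_ac_part_le:
  fixes P :: "'a :: euclidean_space measure"
  assumes "ac_part_density P f" and P: "sets P = sets borel"
    and F [measurable]: "F \<in> borel_measurable borel"
  shows "(\<integral>\<^sup>+x. ennreal (f x) * F x \<partial>lborel) \<le> (\<integral>\<^sup>+x. F x \<partial>P)"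
proof -
  obtain S where [measurable]: "f \<in> borel_measurable borel"
    and S: "\<And>A. A \<in> sets borel \<Longrightarrow>
      emeasure P A = emeasure (density lborel (\<lambda>x. ennreal (f x))) A + emeasure S A"
    using assms(1) unfolding ac_part_density_def by blast
  have "density lborel (\<lambda>x. ennreal (f x)) \<le> P"
    by (subst le_measure) (auto simp: P S)
  then have "(\<integral>\<^sup>+x. F x \<partial>density lborel (\<lambda>x. ennreal (f x))) \<le> (\<integral>\<^sup>+x. F x \<partial>P)"
    by (intro nn_integral_mono_measure) (simp_all add: P)
  then show ?thesis
    by (simp add: nn_integral_density)
qed

lemma density_null_measure:
  assumes "f \<in> borel_measurable M" "(\<integral>\<^sup>+x. f x \<partial>M) = 0"
  shows "density M f = null_measure M"
proof (rule measure_eqI)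
  fix A assume "A \<in> sets (density M f)"
  then have "emeasure (density M f) A = (\<integral>\<^sup>+x. f x * indicator A x \<partial>M)"
    using assms by (simp add: emeasure_density)
  also have "\<dots> \<le> (\<integral>\<^sup>+x. f x \<partial>M)"
    by (intro nn_integral_mono) (auto split: split_indicator)
  finally show "emeasure (density M f) A = emeasure (null_measure M) A"
    using assms by simp
qed simp

lemma voronoi_quantization_error:
  fixes N :: "'a :: euclidean_space \<Rightarrow> real"
  assumes "0 < s" "X \<in> borel_measurable M" "voronoi_quantization N \<alpha> X Y"
    and [measurable]: "(\<lambda>x. set_dist N x \<alpha>) \<in> borel_measurable borel"
  shows "enn_powr (Ls_norm N M s (\<lambda>\<omega>. X \<omega> - Y \<omega>)) s = distortion N s (distr M borel X) \<alpha>"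
proof -
  obtain p where "\<And>x. N (x - p x) = set_dist N x \<alpha>" "Y = p \<circ> X"
    using assms(3) unfolding voronoi_quantization_def by blast
  then have "(\<integral>\<^sup>+\<omega>. ennreal (N (X \<omega> - Y \<omega>) powr s) \<partial>M) = distortion N s (distr M borel X) \<alpha>"
    unfolding distortion_def using assms(2) by (subst nn_integral_distr) auto
  then show ?thesis
    unfolding Ls_norm_def using assms(1) by (simp add: enn_powr_powr)
qed

theorem theorem2p1:
  fixes N :: "real ^ 'n \<Rightarrow> real"
    and M :: "'w measure" and X :: "'w \<Rightarrow> real ^ 'n" and P :: "(real ^ 'n) measure"
    and f :: "real ^ 'n \<Rightarrow> real" and \<alpha> :: "nat \<Rightarrow> (real ^ 'n) set"
    and r s \<eta> :: real
  assumes "is_norm N"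
    and "0 < r" and "0 < s"
    and "prob_space M" and "X \<in> borel_measurable M" and "P = distr M borel X"
    and "ac_part_density P f"
    and "density lborel (\<lambda>x. ennreal (f x)) \<noteq> null_measure lborel"
    and "0 < \<eta>" and "(\<integral>\<^sup>+\<omega>. ennreal (N (X \<omega>) powr (r + \<eta>)) \<partial>M) < \<infinity>"
    and "\<forall>n\<ge>1. quantizer n (\<alpha> n)"
    and "asymp_optimal N r P f \<alpha>"
  shows "\<forall>\<theta>>0. \<forall>\<mu>. \<forall>Y :: nat \<Rightarrow> 'w \<Rightarrow> real ^ 'n.
    (\<forall>n\<ge>1. voronoi_quantization N (dilate \<theta> \<mu> ` \<alpha> n) X (Y n)) \<longrightarrow>
    Q_Inf N r s f \<theta> \<mu>
      \<le> liminf (\<lambda>n. ennreal (real n powr (s / real CARD('n))) *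
                    enn_powr (Ls_norm N M s (\<lambda>\<omega>. X \<omega> - Y n \<omega>)) s)"
proof (intro allI impI)
  fix \<theta> :: real and \<mu> :: "real ^ 'n" and Y :: "nat \<Rightarrow> 'w \<Rightarrow> real ^ 'n"
  assume \<theta>: "0 < \<theta>" and Y: "\<forall>n\<ge>1. voronoi_quantization N (dilate \<theta> \<mu> ` \<alpha> n) X (Y n)"
  obtain lo hi where "comparable_norm N lo hi"
    using is_norm_imp_comparable[OF assms(1)] .
  then interpret comparable_norm N lo hi .
  interpret M: prob_space M by fact
  have [measurable]: "f \<in> borel_measurable borel" and f_nonneg: "0 \<le> f x" for x
    using assms(7) unfolding ac_part_density_def by auto
  have sets_P: "sets P = sets borel"
    by (simp add: assms(6))
  note ac = nn_integral_ac_part_le[OF assms(7) sets_P]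
  have \<alpha>: "finite (\<alpha> n)" "\<alpha> n \<noteq> {}" if "1 \<le> n" for n
    using assms(11) that by (auto simp: quantizer_def)
  define d where "d = real CARD('n)"
  have d: "0 < d" by (simp add: d_def)

  have mass: "(\<integral>\<^sup>+x. ennreal (f x) \<partial>lborel) < \<infinity>"
  proof -
    have "(\<integral>\<^sup>+x. ennreal (f x) \<partial>lborel) \<le> (\<integral>\<^sup>+x. 1 \<partial>P)"
      using ac[of "\<lambda>_. 1"] by simp
    also have "\<dots> = 1"
      using assms(5) M.emeasure_space_1 by (simp add: assms(6) emeasure_distr)
    finally show ?thesis
      by (rule le_less_trans) simp
  qed
  then have f_int: "integrable lborel f"
    by (intro integrableI_nonneg) (auto simp: f_nonneg)
  have "(\<integral>\<^sup>+x. ennreal (f x * N x powr (r + \<eta>)) \<partial>lborel) \<le> (\<integral>\<^sup>+x. ennreal (N x powr (r + \<eta>)) \<partial>P)"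
    using ac[of "\<lambda>x. ennreal (N x powr (r + \<eta>))"] f_nonneg by (simp add: ennreal_mult)
  also have "\<dots> = (\<integral>\<^sup>+\<omega>. ennreal (N (X \<omega>) powr (r + \<eta>)) \<partial>M)"
    unfolding assms(6) using assms(5) by (subst nn_integral_distr) auto
  finally have moment: "(\<integral>\<^sup>+x. ennreal (f x * N x powr (r + \<eta>)) \<partial>lborel) < \<infinity>"
    using assms(10) by (rule le_less_trans)
  have "(\<integral>\<^sup>+x. ennreal (f x powr (d / (d + r))) \<partial>lborel) < \<infinity>"
    unfolding d_def
    by (rule nn_integral_density_powr_finite[where p = "r + \<eta>"]) (use assms f_nonneg mass moment in auto)
  moreover have "(\<integral>\<^sup>+x. ennreal (f x powr (d / (d + r))) \<partial>lborel) \<noteq> 0"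
  proof
    assume "(\<integral>\<^sup>+x. ennreal (f x powr (d / (d + r))) \<partial>lborel) = 0"
    then have "AE x in lborel. ennreal (f x powr (d / (d + r))) = 0"
      by (subst (asm) nn_integral_0_iff_AE) auto
    then have "AE x in lborel. ennreal (f x) = 0"
      by eventually_elim (use f_nonneg in \<open>simp add: ennreal_eq_0_iff\<close>)
    then have "(\<integral>\<^sup>+x. ennreal (f x) \<partial>lborel) = 0"
      by (subst nn_integral_0_iff_AE) auto
    then show False
      using assms(8) density_null_measure[of "\<lambda>x. ennreal (f x)" lborel] by simp
  qed
  ultimately obtain I where I: "(\<integral>\<^sup>+x. ennreal (f x powr (d / (d + r))) \<partial>lborel) = ennreal I" "0 < I"
    by (cases "\<integral>\<^sup>+x. ennreal (f x powr (d / (d + r))) \<partial>lborel") auto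

  (* the factor \<theta>^d is the Jacobian of the dilation, \<theta>^s the scaling of the distances *)
  define g where "g = (\<lambda>x. \<theta> powr (s + d) * f (dilate \<theta> \<mu> x))"
  have dilate_affine: "dilate \<theta> \<mu> = (\<lambda>x. (\<mu> - \<theta> *\<^sub>R \<mu>) + \<theta> *\<^sub>R x)"
    by (auto simp: dilate_def fun_eq_iff algebra_simps)
  have [measurable]: "dilate \<theta> \<mu> \<in> borel_measurable borel"
    unfolding dilate_affine by measurable
  have [measurable]: "g \<in> borel_measurable borel"
    unfolding g_def by measurable
  have g_nonneg: "0 \<le> g x" for x
    by (simp add: g_def f_nonneg)
  have dilate_integral: "(\<integral>\<^sup>+x. F x \<partial>lborel) = ennreal (\<theta> ^ CARD('n)) * (\<integral>\<^sup>+x. F (dilate \<theta> \<mu> x) \<partial>lborel)"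
    if "F \<in> borel_measurable borel" for F
    unfolding dilate_affine using that \<theta> by (rule nn_integral_lborel_affine)
  have g_int: "integrable lborel g"
  proof -
    have "ennreal (\<theta> ^ CARD('n)) * (\<integral>\<^sup>+x. ennreal (f (dilate \<theta> \<mu> x)) \<partial>lborel) < \<infinity>"
      using mass by (subst dilate_integral[symmetric]) auto
    then have "(\<integral>\<^sup>+x. ennreal (f (dilate \<theta> \<mu> x)) \<partial>lborel) < \<infinity>"
      using zero_less_power[OF \<theta>, of "CARD('n)"] by (auto simp: ennreal_mult_less_top ennreal_eq_0_iff)
    then have "integrable lborel (\<lambda>x. f (dilate \<theta> \<mu> x))"
      by (intro integrableI_nonneg) (auto simp: f_nonneg)
    then show ?thesis
      unfolding g_def by (rule integrable_mult_right)
  qed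

  have "Q_Inf N r s f \<theta> \<mu> = quant_const N s * (ennreal (I powr (s / d)) *
      (\<integral>\<^sup>+x \<in> {x. 0 < f x}. ennreal (g x * f x powr (- (s / (d + r)))) \<partial>lborel))"
  proof -
    have "(\<integral>\<^sup>+x \<in> {x. 0 < f x}. ennreal (g x * f x powr (- (s / (d + r)))) \<partial>lborel)
      = (\<integral>\<^sup>+x. ennreal (\<theta> powr (s + d)) * (ennreal (f (dilate \<theta> \<mu> x) * f x powr (- (s / (d + r))))
          * indicator {x. 0 < f x} x) \<partial>lborel)"
      using f_nonneg by (intro nn_integral_cong) (simp add: g_def ennreal_mult mult.assoc)
    also have "\<dots> = ennreal (\<theta> powr (s + d)) *
      (\<integral>\<^sup>+x \<in> {x. 0 < f x}. ennreal (f (dilate \<theta> \<mu> x) * f x powr (- (s / (d + r)))) \<partial>lborel)"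
      by (rule nn_integral_cmult) measurable
    finally show ?thesis
      unfolding Q_Inf_def d_def[symmetric] using I by (simp add: enn_powr_ennreal mult_ac)
  qed
  also have "\<dots> \<le> liminf (\<lambda>n. ennreal (real n powr (s / d)) *
        (\<integral>\<^sup>+x. ennreal (g x * set_dist N x (\<alpha> n) powr s) \<partial>lborel))"
    unfolding d_def
  proof (rule mismatched_distortion_lower_bound)
    show "(\<lambda>n. ennreal (real n powr (r / real CARD('n))) * distortion N r P (\<alpha> n))
        \<longlonglongrightarrow> quant_const N r * ennreal (I powr ((real CARD('n) + r) / real CARD('n)))"
      using assms(12) I unfolding asymp_optimal_def Q_const_def d_def by (simp add: enn_powr_ennreal)
    fix n :: nat assume n: "1 \<le> n"
    have "(\<integral>\<^sup>+x. ennreal (f x * set_dist N x (\<alpha> n) powr r) \<partial>lborel) \<le> distortion N r P (\<alpha> n)"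
      using ac[of "\<lambda>x. ennreal (set_dist N x (\<alpha> n) powr r)"] \<alpha>[OF n] f_nonneg
      by (simp add: distortion_def ennreal_mult)
    then show "ennreal (real n powr (r / real CARD('n))) * (\<integral>\<^sup>+x. ennreal (f x * set_dist N x (\<alpha> n) powr r) \<partial>lborel)
        \<le> ennreal (real n powr (r / real CARD('n))) * distortion N r P (\<alpha> n)"
      by (rule mult_left_mono) simp
  qed (use assms f_int f_nonneg g_int g_nonneg I in \<open>auto simp: d_def\<close>)
  also have "\<dots> \<le> liminf (\<lambda>n. ennreal (real n powr (s / real CARD('n))) *
                    enn_powr (Ls_norm N M s (\<lambda>\<omega>. X \<omega> - Y n \<omega>)) s)"
  proof (rule Liminf_mono, use eventually_ge_at_top[of 1] in eventually_elim)
    fix n :: nat assume n: "1 \<le> n"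
    let ?\<beta> = "dilate \<theta> \<mu> ` \<alpha> n"
    have \<beta>: "finite ?\<beta>" "?\<beta> \<noteq> {}"
      using \<alpha>[OF n] by auto
    have sd: "set_dist N (dilate \<theta> \<mu> x) ?\<beta> = \<theta> * set_dist N x (\<alpha> n)" for x
      unfolding dilate_affine by (rule set_dist_affine[OF \<alpha>[OF n] \<theta>])
    have "(\<integral>\<^sup>+x. ennreal (g x * set_dist N x (\<alpha> n) powr s) \<partial>lborel)
      = (\<integral>\<^sup>+x. ennreal (\<theta> ^ CARD('n)) * (ennreal (f (dilate \<theta> \<mu> x)) * ennreal (set_dist N (dilate \<theta> \<mu> x) ?\<beta> powr s)) \<partial>lborel)"
    proof (rule nn_integral_cong)
      fix x
      have "g x * set_dist N x (\<alpha> n) powr s = \<theta> ^ CARD('n) * (f (dilate \<theta> \<mu> x) * set_dist N (dilate \<theta> \<mu> x) ?\<beta> powr s)"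
        unfolding sd g_def using \<theta> set_dist_nonneg[OF \<alpha>[OF n], of x]
        by (simp add: powr_add powr_mult d_def powr_realpow)
      then show "ennreal (g x * set_dist N x (\<alpha> n) powr s)
        = ennreal (\<theta> ^ CARD('n)) * (ennreal (f (dilate \<theta> \<mu> x)) * ennreal (set_dist N (dilate \<theta> \<mu> x) ?\<beta> powr s))"
        using \<theta> f_nonneg by (simp add: ennreal_mult)
    qed
    also have "\<dots> = ennreal (\<theta> ^ CARD('n)) * (\<integral>\<^sup>+x. ennreal (f (dilate \<theta> \<mu> x)) * ennreal (set_dist N (dilate \<theta> \<mu> x) ?\<beta> powr s) \<partial>lborel)"
      unfolding sd using \<alpha>[OF n] by (intro nn_integral_cmult) measurable
    also have "\<dots> = (\<integral>\<^sup>+x. ennreal (f x) * ennreal (set_dist N x ?\<beta> powr s) \<partial>lborel)"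
      using \<beta> by (subst dilate_integral) auto
    also have "\<dots> \<le> distortion N s P ?\<beta>"
      unfolding distortion_def using \<beta> by (intro ac) measurable
    also have "\<dots> = enn_powr (Ls_norm N M s (\<lambda>\<omega>. X \<omega> - Y n \<omega>)) s"
      unfolding assms(6) using assms Y n \<beta> by (intro voronoi_quantization_error[symmetric]) auto
    finally show "ennreal (real n powr (s / d)) * (\<integral>\<^sup>+x. ennreal (g x * set_dist N x (\<alpha> n) powr s) \<partial>lborel)
      \<le> ennreal (real n powr (s / real CARD('n))) * enn_powr (Ls_norm N M s (\<lambda>\<omega>. X \<omega> - Y n \<omega>)) s"
      unfolding d_def by (rule mult_left_mono) simp
  qed
  finally show "Q_Inf N r s f \<theta> \<mu>
      \<le> liminf (\<lambda>n. ennreal (real n powr (s / real CARD('n))) *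
                    enn_powr (Ls_norm N M s (\<lambda>\<omega>. X \<omega> - Y n \<omega>)) s)" .
qed

end
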